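(* Let $R$ be a nonzero ring with a proper ideal $\mathfrak{i}$, an automorphism $\tau$ and a left $\tau$-derivation $\delta$ satisfying the standing assumptions (1)–(5) listed in the context, let $S = R[y;\tau,\delta]$ be the skew polynomial ring and let $T = R[[y;\tau,\delta]] \supseteq S$ be the skew power series ring. Assume that $\tau$ extends to compatible automorphisms of $S$ and $T$, i.e. $\tau$ extends to an automorphism of $T$ (also denoted $\tau$) that restricts to an automorphism of $S$. Then: (i) If $Q$ is a $\tau$-$\delta$-prime ideal of $R$, then there exists a $\tau$-prime ideal $P$ of $T$ such that $P \cap R = Q$. (ii) If $P$ is a $\tau$-prime ideal of $T$, then $P \cap R$ is a $\tau$-$\delta$-prime ideal of $R$.
   Context: All rings are associative with identity $1$; "ideal" means two-sided ideal; "noetherian" means left and right noetherian. Standing assumptions. (1) $R$ is a nonzero ring containing a proper ideal $\mathfrak{i}$. (2) The $\mathfrak{i}$-adic filtration of $R$ is separated ($\bigcap_n \mathfrak{i}^n = 0$) and complete (Cauchy sequences in the $\mathfrak{i}$-adic topology converge). (3) The associated graded ring $\operatorname{gr} R = \bigoplus_{n\ge 0} \mathfrak{i}^n/\mathfrak{i}^{n+1}$ is noetherian (it follows that $R$ is noetherian and that all one-sided ideals of $R$ are closed). (4) $\tau$ is an automorphism of $R$ and $\delta$ is a left $\tau$-derivation of $R$, i.e. an additive map with $\delta(ab) = \tau(a)\delta(b) + \delta(a)b$ for all $a,b\in R$; moreover $\tau(\mathfrak{i}) = \mathfrak{i}$ and $\tau$ induces an automorphism $\overline{\tau}$ of $\operatorname{gr}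 R$ with $\overline{\tau}(\operatorname{gr}(a)) = \operatorname{gr}(\tau(a))$ for $a \in R$, where $\operatorname{gr}(a)$ is the class of $a$ in $\mathfrak{i}^m/\mathfrak{i}^{m+1}$ for $a \in \mathfrak{i}^m\setminus \mathfrak{i}^{m+1}$ and $\operatorname{gr}(0)=0$. (5) $\delta(R) \subseteq \mathfrak{i}$ and $\delta(\mathfrak{i}) \subseteq \mathfrak{i}^2$. Skew polynomial ring. $S = R[y;\tau,\delta]$ consists of the polynomials $r_0 + r_1 y + \cdots + r_n y^n$ ($r_i\in R$), with multiplication determined by $yr = \tau(r)y + \delta(r)$ for $r \in R$. For $i \ge 0$ define maps $\theta_{i,k}: R\to R$ by $y^i r = \sum_{k=0}^{i} \theta_{i,k}(r) y^k$ in $S$, with $\theta_{i,k} = 0$ for $k<0$ or $k>i$. Skew power series ring. $T = R[[y;\tau,\delta]]$ is the set of formal series $\sum_{i=0}^\infty r_i y^i$ ($r_i \in R$), with coefficientwise addition and multiplication $$\Big(\sum a_i y^i\Big)\Big(\sum b_j y^j\Big) = \sum_{n=0}^\infty \Big(\sum_{j=0}^n \Big(\sum_{i=0}^\infty a_i\theta_{i,n-j}(b_j)\Big)\Big) y^n ;$$ since $\theta_{i,k}(R)\subseteq \mathfrak{i}^{i-k}$ for $i \geq k$, the inner sums converge in the $\mathfrak{i}$-adic topology, and $T$ is an associative unital ring containing $S$ (hence $R$) as a subring. Prime notions. For a ring $A$ with an automorphism $\alpha$, an ideal $I$ is an $\alpha$-ideal if $\alpha(I)\subseteq I$ (equivalently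 $\alpha(I)=I$ when $A$ is right noetherian). A nonzero ring $A$ is $\alpha$-prime if the product of two nonzero $\alpha$-ideals of $A$ is always nonzero; a proper $\alpha$-ideal $P$ of $A$ is $\alpha$-prime if $A/P$ is $\alpha$-prime under the induced action of $\alpha$. An ideal $I$ of $R$ is a $\tau$-$\delta$-ideal if $\tau(I)=I$ and $\delta(I)\subseteq I$. A ring is $\tau$-$\delta$-prime if the product of nonzero $\tau$-$\delta$-ideals is always nonzero; a proper $\tau$-$\delta$-ideal $Q$ of $R$ is $\tau$-$\delta$-prime if $R/Q$ is $\tau$-$\delta$-prime under the induced actions of $\tau$ and $\delta$. *)

theory Defs
  imports "HOL-Algebra.QuotRing" "HOL-Algebra.Ideal_Product" "HOL-Algebra.UnivPoly"
begin

text \<open>Rings are those of \<^theory>\<open>HOL-Algebra.Ring\<close>: associative, with identity, not necessarily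
  commutative. The library's \<open>noetherian_ring\<close> only speaks about two-sided ideals, so the
  one-sided notions are introduced here.\<close>

definition left_ideal :: "'a set \<Rightarrow> ('a, 'b) ring_scheme \<Rightarrow> bool" where
  "left_ideal J R \<longleftrightarrow>
     additive_subgroup J R \<and> (\<forall>r\<in>carrier R. \<forall>x\<in>J. r \<otimes>\<^bsub>R\<^esub> x \<in> J)"

definition right_ideal :: "'a set \<Rightarrow> ('a, 'b) ring_scheme \<Rightarrow> bool" where
  "right_ideal J R \<longleftrightarrow>
     additive_subgroup J R \<and> (\<forall>r\<in>carrier R. \<forall>x\<in>J. x \<otimes>\<^bsub>R\<^esub> r \<in> J)"

definition left_noetherian :: "('a, 'b) ring_scheme \<Rightarrow> bool" where
  "left_noetherian R \<longleftrightarrow>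
     (\<forall>J :: nat \<Rightarrow> 'a set. (\<forall>n. left_ideal (J n) R) \<and> (\<forall>n. J n \<subseteq> J (Suc n)) \<longrightarrow>
        (\<exists>N. \<forall>n\<ge>N. J n = J N))"

definition right_noetherian :: "('a, 'b) ring_scheme \<Rightarrow> bool" where
  "right_noetherian R \<longleftrightarrow>
     (\<forall>J :: nat \<Rightarrow> 'a set. (\<forall>n. right_ideal (J n) R) \<and> (\<forall>n. J n \<subseteq> J (Suc n)) \<longrightarrow>
        (\<exists>N. \<forall>n\<ge>N. J n = J N))"

definition two_sided_noetherian :: "('a, 'b) ring_scheme \<Rightarrow> bool" where
  "two_sided_noetherian R \<longleftrightarrow> left_noetherian R \<and> right_noetherian R"


section \<open>The adic filtration\<close>

definition ideal_pow :: "('a, 'b) ring_scheme \<Rightarrow> 'a set \<Rightarrow> nat \<Rightarrow> 'a set" where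
  "ideal_pow R I n = (ideal_prod R I ^^ n) (carrier R)"

definition adic_separated :: "('a, 'b) ring_scheme \<Rightarrow> 'a set \<Rightarrow> bool" where
  "adic_separated R I \<longleftrightarrow> (\<Inter>n. ideal_pow R I n) = {\<zero>\<^bsub>R\<^esub>}"

definition adic_Cauchy :: "('a, 'b) ring_scheme \<Rightarrow> 'a set \<Rightarrow> (nat \<Rightarrow> 'a) \<Rightarrow> bool" where
  "adic_Cauchy R I s \<longleftrightarrow>
     (\<forall>n. \<exists>N. \<forall>p\<ge>N. \<forall>q\<ge>N. s p \<ominus>\<^bsub>R\<^esub> s q \<in> ideal_pow R I n)"

definition adic_lim :: "('a, 'b) ring_scheme \<Rightarrow> 'a set \<Rightarrow> (nat \<Rightarrow> 'a) \<Rightarrow> 'a \<Rightarrow> bool" where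
  "adic_lim R I s l \<longleftrightarrow>
     l \<in> carrier R \<and> (\<forall>n. \<exists>N. \<forall>p\<ge>N. s p \<ominus>\<^bsub>R\<^esub> l \<in> ideal_pow R I n)"

definition adic_complete :: "('a, 'b) ring_scheme \<Rightarrow> 'a set \<Rightarrow> bool" where
  "adic_complete R I \<longleftrightarrow>
     (\<forall>s. (\<forall>n. s n \<in> carrier R) \<and> adic_Cauchy R I s \<longrightarrow> (\<exists>l. adic_lim R I s l))"

text \<open>The sum of a series; the limit is unique when the filtration is separated.\<close>

definition adic_suminf :: "('a, 'b) ring_scheme \<Rightarrow> 'a set \<Rightarrow> (nat \<Rightarrow> 'a) \<Rightarrow> 'a" where
  "adic_suminf R I s = (THE l. adic_lim R I (\<lambda>N. \<Oplus>\<^bsub>R\<^esub>i\<in>{..<N}. s i) l)"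


section \<open>The associated graded ring\<close>

text \<open>An element of \<open>gr R\<close> is a family whose \<open>n\<close>-th member is a coset of \<open>I\<^sup>n\<^sup>+\<^sup>1\<close> in \<open>I\<^sup>n\<close>, almost all
  members being zero, i.e. equal to \<open>I\<^sup>n\<^sup>+\<^sup>1\<close>. In a product, the \<open>n\<close>-th member is a sum in
  \<open>R/I\<^sup>n\<^sup>+\<^sup>1\<close>; for \<open>k \<le> n\<close>, \<open>x \<in> I\<^sup>k\<close> and \<open>y \<in> I\<^sup>n\<^sup>-\<^sup>k\<close>, the set
  \<open>rcoset_mult R I\<^sup>n\<^sup>+\<^sup>1 (x + I\<^sup>k\<^sup>+\<^sup>1) (y + I\<^sup>n\<^sup>-\<^sup>k\<^sup>+\<^sup>1)\<close> is the single coset \<open>xy + I\<^sup>n\<^sup>+\<^sup>1\<close>.\<close>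

definition gr_ring :: "('a, 'b) ring_scheme \<Rightarrow> 'a set \<Rightarrow> (nat \<Rightarrow> 'a set) ring" where
  "gr_ring R I =
     \<lparr>carrier = {f. (\<forall>n. \<exists>x\<in>ideal_pow R I n. f n = ideal_pow R I (Suc n) +>\<^bsub>R\<^esub> x) \<and>
                    finite {n. f n \<noteq> ideal_pow R I (Suc n)}},
      mult = (\<lambda>f g n. \<Oplus>\<^bsub>R Quot ideal_pow R I (Suc n)\<^esub>k\<in>{..n}.
                        rcoset_mult R (ideal_pow R I (Suc n)) (f k) (g (n - k))),
      one = (\<lambda>n. if n = 0 then ideal_pow R I 1 +>\<^bsub>R\<^esub> \<one>\<^bsub>R\<^esub> else ideal_pow R I (Suc n)),
      zero = (\<lambda>n. ideal_pow R I (Suc n)),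
      add = (\<lambda>f g n. f n <+>\<^bsub>R\<^esub> g n)\<rparr>"

text \<open>For a separated filtration and nonzero \<open>a\<close> the first branch applies to exactly one \<open>n\<close>; for
  \<open>a = 0\<close> it never applies.\<close>

definition gr_symbol :: "('a, 'b) ring_scheme \<Rightarrow> 'a set \<Rightarrow> 'a \<Rightarrow> nat \<Rightarrow> 'a set" where
  "gr_symbol R I a =
     (\<lambda>n. if a \<in> ideal_pow R I n - ideal_pow R I (Suc n)
          then ideal_pow R I (Suc n) +>\<^bsub>R\<^esub> a else ideal_pow R I (Suc n))"


section \<open>Skew polynomials and skew power series\<close>

definition left_skew_derivation ::
    "('a, 'b) ring_scheme \<Rightarrow> ('a \<Rightarrow> 'a) \<Rightarrow> ('a \<Rightarrow> 'a) \<Rightarrow> bool" where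
  "left_skew_derivation R \<tau> \<delta> \<longleftrightarrow>
     \<delta> \<in> carrier R \<rightarrow> carrier R \<and>
     (\<forall>a\<in>carrier R. \<forall>b\<in>carrier R. \<delta> (a \<oplus>\<^bsub>R\<^esub> b) = \<delta> a \<oplus>\<^bsub>R\<^esub> \<delta> b) \<and>
     (\<forall>a\<in>carrier R. \<forall>b\<in>carrier R.
        \<delta> (a \<otimes>\<^bsub>R\<^esub> b) = \<tau> a \<otimes>\<^bsub>R\<^esub> \<delta> b \<oplus>\<^bsub>R\<^esub> \<delta> a \<otimes>\<^bsub>R\<^esub> b)"

text \<open>Polynomials and power series are identified with their sequences of (left) coefficients.
  Left multiplication by \<open>y\<close> is given by \<open>y (\<Sum> r\<^sub>k y\<^sup>k) = \<Sum> (\<tau> r\<^sub>k y + \<delta> r\<^sub>k) y\<^sup>k\<close>, and therefore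
  \<open>(\<Sum> a\<^sub>i y\<^sup>i) g = \<Sum> a\<^sub>i (y\<^sup>i g)\<close> determines the multiplication of skew polynomials.\<close>

definition y_times ::
    "('a, 'b) ring_scheme \<Rightarrow> ('a \<Rightarrow> 'a) \<Rightarrow> ('a \<Rightarrow> 'a) \<Rightarrow> (nat \<Rightarrow> 'a) \<Rightarrow> nat \<Rightarrow> 'a" where
  "y_times R \<tau> \<delta> g = (\<lambda>n. (if n = 0 then \<zero>\<^bsub>R\<^esub> else \<tau> (g (n - 1))) \<oplus>\<^bsub>R\<^esub> \<delta> (g n))"

definition monomial :: "('a, 'b) ring_scheme \<Rightarrow> 'a \<Rightarrow> nat \<Rightarrow> nat \<Rightarrow> 'a" where
  "monomial R r i = (\<lambda>n. if n = i then r else \<zero>\<^bsub>R\<^esub>)"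

abbreviation const_series :: "('a, 'b) ring_scheme \<Rightarrow> 'a \<Rightarrow> nat \<Rightarrow> 'a" where
  "const_series R r \<equiv> monomial R r 0"

definition skew_poly ::
    "('a, 'b) ring_scheme \<Rightarrow> ('a \<Rightarrow> 'a) \<Rightarrow> ('a \<Rightarrow> 'a) \<Rightarrow> (nat \<Rightarrow> 'a) ring" where
  "skew_poly R \<tau> \<delta> =
     \<lparr>carrier = up R,
      mult = (\<lambda>f g n. \<Oplus>\<^bsub>R\<^esub>i\<in>{i. f i \<noteq> \<zero>\<^bsub>R\<^esub>}. f i \<otimes>\<^bsub>R\<^esub> (y_times R \<tau> \<delta> ^^ i) g n),
      one = const_series R \<one>\<^bsub>R\<^esub>,
      zero = (\<lambda>n. \<zero>\<^bsub>R\<^esub>),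
      add = (\<lambda>f g n. f n \<oplus>\<^bsub>R\<^esub> g n)\<rparr>"

abbreviation skew_y :: "('a, 'b) ring_scheme \<Rightarrow> nat \<Rightarrow> 'a" where
  "skew_y R \<equiv> monomial R \<one>\<^bsub>R\<^esub> 1"

definition skew_theta ::
    "('a, 'b) ring_scheme \<Rightarrow> ('a \<Rightarrow> 'a) \<Rightarrow> ('a \<Rightarrow> 'a) \<Rightarrow> nat \<Rightarrow> nat \<Rightarrow> 'a \<Rightarrow> 'a" where
  "skew_theta R \<tau> \<delta> i k r =
     (skew_y R [^]\<^bsub>skew_poly R \<tau> \<delta>\<^esub> i \<otimes>\<^bsub>skew_poly R \<tau> \<delta>\<^esub> const_series R r) k"

definition skew_power_series ::
    "('a, 'b) ring_scheme \<Rightarrow> 'a set \<Rightarrow> ('a \<Rightarrow> 'a) \<Rightarrow> ('a \<Rightarrow> 'a) \<Rightarrow> (nat \<Rightarrow> 'a) ring" where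
  "skew_power_series R I \<tau> \<delta> =
     \<lparr>carrier = UNIV \<rightarrow> carrier R,
      mult = (\<lambda>a b n. \<Oplus>\<^bsub>R\<^esub>j\<in>{..n}.
                        adic_suminf R I (\<lambda>i. a i \<otimes>\<^bsub>R\<^esub> skew_theta R \<tau> \<delta> i (n - j) (b j))),
      one = const_series R \<one>\<^bsub>R\<^esub>,
      zero = (\<lambda>n. \<zero>\<^bsub>R\<^esub>),
      add = (\<lambda>f g n. f n \<oplus>\<^bsub>R\<^esub> g n)\<rparr>"

lemma skew_poly_commutation:
  assumes "ring R" "\<one>\<^bsub>R\<^esub> \<noteq> \<zero>\<^bsub>R\<^esub>" "\<tau> \<in> ring_iso R R" "left_skew_derivation R \<tau> \<delta>"
    and r: "r \<in> carrier R"
  shows "skew_y R \<otimes>\<^bsub>skew_poly R \<tau> \<delta>\<^esub> const_series R r =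
         (const_series R (\<tau> r) \<otimes>\<^bsub>skew_poly R \<tau> \<delta>\<^esub> skew_y R) \<oplus>\<^bsub>skew_poly R \<tau> \<delta>\<^esub> const_series R (\<delta> r)"
proof -
  interpret ring R by fact
  have hom: "\<tau> \<in> ring_hom R R" using assms(3) by (simp add: ring_iso_def)
  have \<tau>: "\<tau> x \<in> carrier R" if "x \<in> carrier R" for x
    using hom that by (rule ring_hom_closed)
  have \<delta>: "\<delta> x \<in> carrier R" if "x \<in> carrier R" for x
    using assms(4) that by (auto simp: left_skew_derivation_def)
  have \<tau>0: "\<tau> \<zero>\<^bsub>R\<^esub> = \<zero>\<^bsub>R\<^esub>"
    using hom ring_hom_zero[OF hom] assms(1) by blast
  have "\<delta> \<zero>\<^bsub>R\<^esub> \<oplus>\<^bsub>R\<^esub> \<delta> \<zero>\<^bsub>R\<^esub> = \<delta> \<zero>\<^bsub>R\<^esub>"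
    using assms(4) unfolding left_skew_derivation_def by (metis l_zero zero_closed)
  then have \<delta>0: "\<delta> \<zero>\<^bsub>R\<^esub> = \<zero>\<^bsub>R\<^esub>"
    using \<delta>[OF zero_closed] by (metis add.l_cancel_one)
  have supp1: "{i. skew_y R i \<noteq> \<zero>\<^bsub>R\<^esub>} = {1}"
    using assms(2) by (auto simp: monomial_def)
  have supp0: "{i. const_series R (\<tau> r) i \<noteq> \<zero>\<^bsub>R\<^esub>} = (if \<tau> r = \<zero>\<^bsub>R\<^esub> then {} else {0})"
    by (auto simp: monomial_def)
  show ?thesis
    unfolding skew_poly_def monoid.simps ring.simps supp1 supp0
    using r \<tau> \<delta> \<tau>0 \<delta>0 by (auto simp: y_times_def monomial_def fun_eq_iff)
qed


section \<open>Prime notions\<close>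

text \<open>The map on a quotient induced by \<open>f\<close>: if \<open>f\<close> is additive and maps \<open>J\<close> into itself, this
  sends \<open>x + J\<close> to \<open>f x + J\<close>.\<close>

definition induced_map ::
    "('a, 'b) ring_scheme \<Rightarrow> 'a set \<Rightarrow> ('a \<Rightarrow> 'a) \<Rightarrow> 'a set \<Rightarrow> 'a set" where
  "induced_map R J f X = (\<Union>x\<in>X. J +>\<^bsub>R\<^esub> f x)"

definition alpha_ideal :: "('a, 'b) ring_scheme \<Rightarrow> ('a \<Rightarrow> 'a) \<Rightarrow> 'a set \<Rightarrow> bool" where
  "alpha_ideal A \<alpha> I \<longleftrightarrow> ideal I A \<and> \<alpha> ` I \<subseteq> I"

definition alpha_prime_ring :: "('a, 'b) ring_scheme \<Rightarrow> ('a \<Rightarrow> 'a) \<Rightarrow> bool" where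
  "alpha_prime_ring A \<alpha> \<longleftrightarrow>
     carrier A \<noteq> {\<zero>\<^bsub>A\<^esub>} \<and>
     (\<forall>I J. alpha_ideal A \<alpha> I \<and> alpha_ideal A \<alpha> J \<and> I \<noteq> {\<zero>\<^bsub>A\<^esub>} \<and> J \<noteq> {\<zero>\<^bsub>A\<^esub>} \<longrightarrow>
        ideal_prod A I J \<noteq> {\<zero>\<^bsub>A\<^esub>})"

definition alpha_prime_ideal :: "('a, 'b) ring_scheme \<Rightarrow> ('a \<Rightarrow> 'a) \<Rightarrow> 'a set \<Rightarrow> bool" where
  "alpha_prime_ideal A \<alpha> P \<longleftrightarrow>
     alpha_ideal A \<alpha> P \<and> P \<noteq> carrier A \<and> alpha_prime_ring (A Quot P) (induced_map A P \<alpha>)"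

definition tau_delta_ideal ::
    "('a, 'b) ring_scheme \<Rightarrow> ('a \<Rightarrow> 'a) \<Rightarrow> ('a \<Rightarrow> 'a) \<Rightarrow> 'a set \<Rightarrow> bool" where
  "tau_delta_ideal R \<tau> \<delta> I \<longleftrightarrow> ideal I R \<and> \<tau> ` I = I \<and> \<delta> ` I \<subseteq> I"

definition tau_delta_prime_ring ::
    "('a, 'b) ring_scheme \<Rightarrow> ('a \<Rightarrow> 'a) \<Rightarrow> ('a \<Rightarrow> 'a) \<Rightarrow> bool" where
  "tau_delta_prime_ring R \<tau> \<delta> \<longleftrightarrow>
     (\<forall>I J. tau_delta_ideal R \<tau> \<delta> I \<and> tau_delta_ideal R \<tau> \<delta> J \<and> I \<noteq> {\<zero>\<^bsub>R\<^esub>} \<and> J \<noteq> {\<zero>\<^bsub>R\<^esub>} \<longrightarrow>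
        ideal_prod R I J \<noteq> {\<zero>\<^bsub>R\<^esub>})"

definition tau_delta_prime_ideal ::
    "('a, 'b) ring_scheme \<Rightarrow> ('a \<Rightarrow> 'a) \<Rightarrow> ('a \<Rightarrow> 'a) \<Rightarrow> 'a set \<Rightarrow> bool" where
  "tau_delta_prime_ideal R \<tau> \<delta> Q \<longleftrightarrow>
     tau_delta_ideal R \<tau> \<delta> Q \<and> Q \<noteq> carrier R \<and>
     tau_delta_prime_ring (R Quot Q) (induced_map R Q \<tau>) (induced_map R Q \<delta>)"

text \<open>\<open>P \<inter> R\<close> for a set \<open>P\<close> of series, \<open>R\<close> being embedded as the constant series.\<close>

definition contraction :: "('a, 'b) ring_scheme \<Rightarrow> (nat \<Rightarrow> 'a) set \<Rightarrow> 'a set" where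
  "contraction R P = {r \<in> carrier R. const_series R r \<in> P}"

end

theory Submission
  imports Defs "HOL-Algebra.Ring_Divisibility"
begin

text \<open>Let \<open>K\<close> be an ideal of \<open>R\<close> stable under \<open>\<tau>\<close> and \<open>\<delta>\<close>. Since \<open>gr R\<close> is right noetherian and \<open>R\<close> is
  complete, successive approximation shows that \<open>K\<close> is closed and finitely generated as a right
  ideal. Hence the series with coefficients in \<open>K\<close> form an ideal \<open>K[[y]] = K T\<close> of \<open>T\<close>, which is
  \<open>\<tau>\<close>-stable and contracts to \<open>K\<close>; moreover \<open>A[[y]] B[[y]] \<subseteq> Q[[y]]\<close> whenever \<open>A B \<subseteq> Q\<close>.

  Conversely the contraction of a \<open>\<tau>\<close>-ideal is a \<open>\<tau>\<close>-\<open>\<delta>\<close>-ideal, because \<open>\<delta> q = y q - \<tau> q y\<close>. For (i),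
  Zorn's lemma gives a \<open>\<tau>\<close>-ideal \<open>P\<close> maximal among those contracting to \<open>Q\<close>: strictly larger
  \<open>\<tau>\<close>-ideals contract to strictly larger ideals, so \<open>P\<close> is \<open>\<tau>\<close>-prime because \<open>Q\<close> is
  \<open>\<tau>\<close>-\<open>\<delta>\<close>-prime. For (ii), if \<open>A B \<subseteq> P \<inter> R\<close>, then \<open>(P + A[[y]]) (P + B[[y]]) \<subseteq> P\<close>.

  Associativity of \<open>T\<close> rests on the description \<open>(a b)\<^sub>n = \<Sum>\<^sub>i a\<^sub>i (Y\<^sup>i b)\<^sub>n\<close> of the product, where \<open>Y\<close> is
  left multiplication by \<open>y\<close>.\<close>

section \<open>Convergent series in an adic ring\<close>

text \<open>Coefficients stand on the left, so a series with coefficients in \<open>K\<close>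
  factors through finitely many elements of \<open>K\<close> if these generate \<open>K\<close> as a
  right ideal: \<open>f n = \<Sum> x_p c_np\<close> gives \<open>f = \<Sum> x_p g_p\<close> with
  \<open>g_p = \<Sum> c_np y^n\<close>. This fixes the side on which the chain condition is used.
  The factorisation also controls \<open>\<sigma>\<close>, which is known only as a ring map with
  given values on constants: \<open>\<sigma>\<close> of such an \<open>f\<close> is a finite sum of
  products with left factors \<open>\<tau> x_p\<close>.

  A second obstacle is that \<open>\<alpha>\<close>-ideals are merely mapped into themselves, while
  \<open>\<tau>\<close>-\<open>\<delta>\<close>-ideals satisfy \<open>\<tau> K = K\<close>. The
  ascending chain condition for right ideals of \<open>R\<close> closes this gap.

  Finite generation, closedness and the chain condition are all read off from one approximation
  theorem about the adic closure of a right ideal. Zorn's lemma supplies the maximal ideal, so that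
  no chain condition for \<open>T\<close> has to be established.\<close>

locale adic_ring = ideal I R for I and R (structure) +
  assumes separated: "adic_separated R I" and complete: "adic_complete R I"
begin

section \<open>Powers of the ideal\<close>

abbreviation pw :: "nat \<Rightarrow> 'a set" where "pw n \<equiv> ideal_pow R I n"

lemma pw_0: "pw 0 = carrier R"
  by (simp add: ideal_pow_def)

lemma pw_Suc: "pw (Suc n) = ideal_prod R I (pw n)"
  by (simp add: ideal_pow_def)

lemma pw_ideal: "ideal (pw n) R"
  by (induction n) (auto simp: pw_0 pw_Suc oneideal ideal_prod_is_ideal is_ideal)

lemma pw_carrier: "x \<in> pw n \<Longrightarrow> x \<in> carrier R"
  using ideal.Icarr[OF pw_ideal] by blast

lemma pw_zero [simp]: "\<zero> \<in> pw n"
  using additive_subgroup.zero_closed[OF ideal.axioms(1)[OF pw_ideal]] .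

lemma pw_add: "x \<in> pw n \<Longrightarrow> y \<in> pw n \<Longrightarrow> x \<oplus> y \<in> pw n"
  using additive_subgroup.a_closed[OF ideal.axioms(1)[OF pw_ideal]] .

lemma pw_neg: "x \<in> pw n \<Longrightarrow> \<ominus> x \<in> pw n"
  using additive_subgroup.a_inv_closed[OF ideal.axioms(1)[OF pw_ideal]] .

lemma pw_minus: "x \<in> pw n \<Longrightarrow> y \<in> pw n \<Longrightarrow> x \<ominus> y \<in> pw n"
  by (simp add: a_minus_def pw_add pw_neg)

lemma pw_l: "x \<in> pw n \<Longrightarrow> a \<in> carrier R \<Longrightarrow> a \<otimes> x \<in> pw n"
  using ideal.I_l_closed[OF pw_ideal] .

lemma pw_r: "x \<in> pw n \<Longrightarrow> a \<in> carrier R \<Longrightarrow> x \<otimes> a \<in> pw n"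
  using ideal.I_r_closed[OF pw_ideal] .

lemma pw_Suc_subset: "pw (Suc n) \<subseteq> pw n"
  unfolding pw_Suc using ideal_prod_inter[OF is_ideal pw_ideal] by blast

lemma pw_anti: "m \<le> n \<Longrightarrow> pw n \<subseteq> pw m"
  by (rule lift_Suc_antimono_le[of pw]) (use pw_Suc_subset in auto)

lemma pw_antiD: "x \<in> pw n \<Longrightarrow> m \<le> n \<Longrightarrow> x \<in> pw m"
  using pw_anti by blast

text \<open>Powers are built by multiplying by \<open>I\<close> on the left, so the induction runs
  on the exponent of the left factor and reassociates \<open>(i j) y\<close> as
  \<open>i (j y)\<close>.\<close>

lemma pw_mult: "x \<in> pw m \<Longrightarrow> y \<in> pw n \<Longrightarrow> x \<otimes> y \<in> pw (m + n)"
proof (induction m arbitrary: x)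
  case 0
  then show ?case by (simp add: pw_0 pw_l)
next
  case (Suc m)
  from Suc.prems(1) have "x \<in> ideal_prod R I (pw m)" by (simp add: pw_Suc)
  then show ?case
  proof induction
    case (prod i j)
    then have "i \<otimes> (j \<otimes> y) \<in> pw (Suc (m + n))"
      unfolding pw_Suc by (intro ideal_prod.prod Suc.IH Suc.prems)
    then show ?case
      using prod Suc.prems by (simp add: m_assoc pw_carrier)
  next
    case (sum s1 s2)
    then have "s1 \<in> carrier R" "s2 \<in> carrier R"
      using pw_carrier[of _ "Suc m"] by (auto simp: pw_Suc)
    then show ?case
      using sum Suc.prems by (simp add: l_distr pw_carrier pw_add)
  qed
qed

lemma pw_1: "pw 1 = I"
proof
  show "pw 1 \<subseteq> I"
    using ideal_prod_inter[OF is_ideal oneideal] by (simp add: pw_Suc pw_0)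
  show "I \<subseteq> pw 1"
  proof
    fix x assume x: "x \<in> I"
    then have "x \<otimes> \<one> \<in> pw 1"
      using ideal_prod.prod[of x I \<one> "carrier R" R] by (simp add: pw_Suc pw_0)
    then show "x \<in> pw 1" using x by simp
  qed
qed

lemma pw_finsum: "(\<And>i. i \<in> A \<Longrightarrow> f i \<in> pw n) \<Longrightarrow> finsum R f A \<in> pw n"
proof (induction A rule: infinite_finite_induct)
  case (insert x F)
  then have "f \<in> F \<rightarrow> carrier R" "f x \<in> carrier R" using pw_carrier by auto
  then show ?case using insert by (simp add: pw_add)
qed auto

lemma eq_if_pw: "x \<in> carrier R \<Longrightarrow> y \<in> carrier R \<Longrightarrow> (\<And>n. x \<ominus> y \<in> pw n) \<Longrightarrow> x = y"
proof -
  assume *: "x \<in> carrier R" "y \<in> carrier R" "\<And>n. x \<ominus> y \<in> pw n"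
  then have "x \<ominus> y = \<zero>"
    using separated unfolding adic_separated_def by blast
  moreover have "x = (x \<ominus> y) \<oplus> y" using *(1,2) by algebra
  ultimately show ?thesis using *(2) by simp
qed

text \<open>Membership in the carrier is part of the relation, so that congruences compose without
  side conditions.\<close>

definition adic_cong :: "nat \<Rightarrow> 'a \<Rightarrow> 'a \<Rightarrow> bool" where
  "adic_cong m a b \<longleftrightarrow> a \<in> carrier R \<and> b \<in> carrier R \<and> a \<ominus> b \<in> pw m"

lemma adic_cong_carrier: "adic_cong m a b \<Longrightarrow> a \<in> carrier R" "adic_cong m a b \<Longrightarrow> b \<in> carrier R"
  by (auto simp: adic_cong_def)

lemma adic_cong_refl: "a \<in> carrier R \<Longrightarrow> adic_cong m a a"
  by (simp add: adic_cong_def a_minus_def r_neg)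

lemma adic_cong_sym: "adic_cong m a b \<Longrightarrow> adic_cong m b a"
proof -
  assume *: "adic_cong m a b"
  then have "b \<ominus> a = \<ominus> (a \<ominus> b)"
    by (simp add: adic_cong_def a_minus_def minus_add a_comm)
  then show ?thesis using * by (simp add: adic_cong_def pw_neg)
qed

lemma adic_cong_trans [trans]: "adic_cong m a b \<Longrightarrow> adic_cong m b c \<Longrightarrow> adic_cong m a c"
proof -
  assume *: "adic_cong m a b" "adic_cong m b c"
  then have c: "a \<in> carrier R" "b \<in> carrier R" "c \<in> carrier R" by (auto simp: adic_cong_def)
  then have "a \<ominus> c = (a \<ominus> b) \<oplus> (b \<ominus> c)" by algebra
  then show ?thesis using * by (simp add: adic_cong_def pw_add)
qed

lemma adic_cong_add: "adic_cong m a b \<Longrightarrow> adic_cong m c d \<Longrightarrow> adic_cong m (a \<oplus> c) (b \<oplus> d)"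
proof -
  assume *: "adic_cong m a b" "adic_cong m c d"
  then have c: "a \<in> carrier R" "b \<in> carrier R" "c \<in> carrier R" "d \<in> carrier R"
    by (auto simp: adic_cong_def)
  then have "(a \<oplus> c) \<ominus> (b \<oplus> d) = (a \<ominus> b) \<oplus> (c \<ominus> d)" by algebra
  then show ?thesis using * by (simp add: adic_cong_def pw_add)
qed

lemma adic_cong_finsum:
  "(\<And>i. i \<in> A \<Longrightarrow> adic_cong m (f i) (g i)) \<Longrightarrow> adic_cong m (finsum R f A) (finsum R g A)"
proof (induction A rule: infinite_finite_induct)
  case (insert x F)
  then have "adic_cong m (f x \<oplus> finsum R f F) (g x \<oplus> finsum R g F)"
    by (intro adic_cong_add) auto
  moreover have "f \<in> F \<rightarrow> carrier R" "g \<in> F \<rightarrow> carrier R" "f x \<in> carrier R" "g x \<in> carrier R"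
    using insert.prems by (auto dest: adic_cong_carrier)
  ultimately show ?case using insert.hyps by simp
qed (auto simp: adic_cong_refl)

lemma adic_cong_zero: "adic_cong m a \<zero> \<longleftrightarrow> a \<in> pw m"
  by (auto simp: adic_cong_def pw_carrier a_minus_def)

lemma adic_cong_eq: "(\<And>m. adic_cong m a b) \<Longrightarrow> a = b"
  using eq_if_pw unfolding adic_cong_def by blast

text \<open>A relation keeps the definite description in \<open>adic_suminf\<close> out of the
  convergence arguments; \<open>adic_sums_suminf\<close> connects the two by uniqueness of
  limits.\<close>

definition adic_sums :: "(nat \<Rightarrow> 'a) \<Rightarrow> 'a \<Rightarrow> bool" where
  "adic_sums s l \<longleftrightarrow> (\<forall>i. s i \<in> carrier R) \<and> l \<in> carrier R \<and>
     (\<forall>m. \<exists>p. \<forall>q\<ge>p. adic_cong m (\<Oplus>i\<in>{..<q}. s i) l)"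

lemma adic_sums_carrier: "adic_sums s l \<Longrightarrow> l \<in> carrier R"
  by (simp add: adic_sums_def)

lemma adic_sums_term: "adic_sums s l \<Longrightarrow> s i \<in> carrier R"
  by (simp add: adic_sums_def)

lemma adic_sums_ev: "adic_sums s l \<Longrightarrow> \<exists>p. \<forall>q\<ge>p. adic_cong m (\<Oplus>i\<in>{..<q}. s i) l"
  by (simp add: adic_sums_def)

lemma adic_sums_unique: "adic_sums s l \<Longrightarrow> adic_sums s k \<Longrightarrow> l = k"
proof (rule adic_cong_eq)
  fix m assume *: "adic_sums s l" "adic_sums s k"
  obtain p q where "\<forall>r\<ge>p. adic_cong m (\<Oplus>i\<in>{..<r}. s i) l" "\<forall>r\<ge>q. adic_cong m (\<Oplus>i\<in>{..<r}. s i) k"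
    using *[THEN adic_sums_ev] by meson
  then have "adic_cong m (\<Oplus>i\<in>{..<max p q}. s i) l" "adic_cong m (\<Oplus>i\<in>{..<max p q}. s i) k"
    by simp_all
  then show "adic_cong m l k" by (meson adic_cong_sym adic_cong_trans)
qed

lemma adic_sums_suminf: "adic_sums s l \<Longrightarrow> adic_suminf R I s = l"
proof -
  assume *: "adic_sums s l"
  have "adic_lim R I (\<lambda>N. \<Oplus>i\<in>{..<N}. s i) k \<longleftrightarrow> adic_sums s k" for k
  proof -
    have "(\<Oplus>i\<in>{..<N}. s i) \<in> carrier R" for N
      using * by (intro finsum_closed) (auto simp: adic_sums_term)
    then show ?thesis
      using * by (cases "k \<in> carrier R") (simp_all add: adic_lim_def adic_sums_def adic_cong_def)
  qed
  then show ?thesis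
    unfolding adic_suminf_def using * adic_sums_unique by (metis (no_types, lifting) the_equality)
qed

lemma finsum_lessThan_cong:
  fixes s :: "nat \<Rightarrow> 'a"
  assumes "p \<le> q" "\<And>i. s i \<in> carrier R" "\<And>i. i \<ge> p \<Longrightarrow> s i \<in> pw m"
  shows "adic_cong m (\<Oplus>i\<in>{..<q}. s i) (\<Oplus>i\<in>{..<p}. s i)"
proof -
  have "{..<q} = {..<p} \<union> {p..<q}" using assms(1) by (auto simp: not_less)
  then have "(\<Oplus>i\<in>{..<q}. s i) = (\<Oplus>i\<in>{..<p}. s i) \<oplus> (\<Oplus>i\<in>{p..<q}. s i)"
    by (simp only:) (intro finsum_Un_disjoint, use assms in auto)
  moreover have "adic_cong m (\<Oplus>i\<in>{p..<q}. s i) \<zero>"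
    unfolding adic_cong_zero using assms by (intro pw_finsum) auto
  ultimately show ?thesis
    using adic_cong_add[OF adic_cong_refl[of "\<Oplus>i\<in>{..<p}. s i"], of m "\<Oplus>i\<in>{p..<q}. s i" \<zero>] assms
    by (simp add: Pi_def)
qed

text \<open>Modulo \<open>I^m\<close> the partial sums are constant from \<open>p\<close> on. This
  is how infinite sums are replaced by finite ones below.\<close>

lemma adic_sums_tail:
  assumes "adic_sums s l" "\<And>i. i \<ge> p \<Longrightarrow> s i \<in> pw m"
  shows "adic_cong m l (\<Oplus>i\<in>{..<p}. s i)"
proof -
  obtain q where "\<forall>r\<ge>q. adic_cong m (\<Oplus>i\<in>{..<r}. s i) l"
    using adic_sums_ev[OF assms(1)] by meson
  then have "adic_cong m (\<Oplus>i\<in>{..<max p q}. s i) l" by simp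
  moreover have "adic_cong m (\<Oplus>i\<in>{..<max p q}. s i) (\<Oplus>i\<in>{..<p}. s i)"
    using assms by (intro finsum_lessThan_cong) (auto simp: adic_sums_term)
  ultimately show ?thesis by (meson adic_cong_sym adic_cong_trans)
qed

lemma adic_sums_pw:
  assumes "adic_sums s l" "\<And>i. s i \<in> pw m"
  shows "l \<in> pw m"
  using adic_sums_tail[OF assms(1), of 0 m] assms(2) by (simp add: adic_cong_zero)

text \<open>The topology is non-archimedean: a block of late terms lies in \<open>I^m\<close> as
  soon as each term does, so terms tending to zero already make the partial sums Cauchy.\<close>

lemma adic_sums_exists:
  assumes c: "\<And>i. s i \<in> carrier R" and null: "\<And>m. \<exists>p. \<forall>i\<ge>p. s i \<in> pw m"
  shows "\<exists>l. adic_sums s l"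
proof -
  have cl: "(\<Oplus>i\<in>{..<N}. s i) \<in> carrier R" for N
    using c by (intro finsum_closed) auto
  have cong: "\<exists>p. \<forall>q\<ge>p. adic_cong m (\<Oplus>i\<in>{..<q}. s i) (\<Oplus>i\<in>{..<p}. s i)" for m
  proof -
    obtain p where "\<forall>i\<ge>p. s i \<in> pw m" using null by blast
    then show ?thesis using c finsum_lessThan_cong by blast
  qed
  have "adic_Cauchy R I (\<lambda>N. \<Oplus>i\<in>{..<N}. s i)"
    unfolding adic_Cauchy_def
  proof
    fix m
    obtain p where "\<forall>q\<ge>p. adic_cong m (\<Oplus>i\<in>{..<q}. s i) (\<Oplus>i\<in>{..<p}. s i)" using cong by blast
    then have "\<forall>q\<ge>p. \<forall>r\<ge>p. adic_cong m (\<Oplus>i\<in>{..<q}. s i) (\<Oplus>i\<in>{..<r}. s i)"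
      by (meson adic_cong_sym adic_cong_trans)
    then show "\<exists>N. \<forall>p\<ge>N. \<forall>q\<ge>N. (\<Oplus>i\<in>{..<p}. s i) \<ominus> (\<Oplus>i\<in>{..<q}. s i) \<in> pw m"
      unfolding adic_cong_def by blast
  qed
  then obtain l where "adic_lim R I (\<lambda>N. \<Oplus>i\<in>{..<N}. s i) l"
    using complete[unfolded adic_complete_def, rule_format, of "\<lambda>N. \<Oplus>i\<in>{..<N}. s i"] cl
    by fast
  then show ?thesis
    using cl c by (simp add: adic_lim_def adic_sums_def adic_cong_def) fast
qed

lemma adic_sums_add:
  assumes "adic_sums s l" "adic_sums t k"
  shows "adic_sums (\<lambda>i. s i \<oplus> t i) (l \<oplus> k)"
  unfolding adic_sums_def
proof (intro conjI allI)
  fix m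
  obtain p q where "\<forall>r\<ge>p. adic_cong m (\<Oplus>i\<in>{..<r}. s i) l" "\<forall>r\<ge>q. adic_cong m (\<Oplus>i\<in>{..<r}. t i) k"
    using assms[THEN adic_sums_ev] by meson
  then have "\<forall>r\<ge>max p q. adic_cong m ((\<Oplus>i\<in>{..<r}. s i) \<oplus> (\<Oplus>i\<in>{..<r}. t i)) (l \<oplus> k)"
    by (simp add: adic_cong_add)
  moreover have "(\<Oplus>i\<in>{..<r}. s i \<oplus> t i) = (\<Oplus>i\<in>{..<r}. s i) \<oplus> (\<Oplus>i\<in>{..<r}. t i)" for r
    using assms by (intro finsum_addf) (auto simp: adic_sums_term)
  ultimately show "\<exists>p. \<forall>r\<ge>p. adic_cong m (\<Oplus>i\<in>{..<r}. s i \<oplus> t i) (l \<oplus> k)" by metis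
qed (use assms in \<open>auto simp: adic_sums_term adic_sums_carrier\<close>)

lemma adic_sums_zero: "adic_sums (\<lambda>i. \<zero>) \<zero>"
  by (auto simp: adic_sums_def adic_cong_zero)

lemma adic_sums_finsum:
  "(\<And>j. j \<in> A \<Longrightarrow> adic_sums (s j) (l j)) \<Longrightarrow> adic_sums (\<lambda>i. \<Oplus>j\<in>A. s j i) (\<Oplus>j\<in>A. l j)"
proof (induction A rule: infinite_finite_induct)
  case (insert x F)
  then have "adic_sums (\<lambda>i. s x i \<oplus> (\<Oplus>j\<in>F. s j i)) (l x \<oplus> (\<Oplus>j\<in>F. l j))"
    by (intro adic_sums_add) auto
  moreover have "(\<lambda>j. s j i) \<in> F \<rightarrow> carrier R" "s x i \<in> carrier R" for i
    using insert.prems adic_sums_term by auto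
  moreover have "l \<in> F \<rightarrow> carrier R" "l x \<in> carrier R"
    using insert.prems by (auto dest: adic_sums_carrier)
  ultimately show ?case using insert.hyps by simp
qed (auto simp: adic_sums_zero)

lemma additive_finsum:
  assumes "\<And>x. x \<in> carrier R \<Longrightarrow> f x \<in> carrier R" "f \<zero> = \<zero>"
    and "\<And>x y. x \<in> carrier R \<Longrightarrow> y \<in> carrier R \<Longrightarrow> f (x \<oplus> y) = f x \<oplus> f y"
    and "\<And>i. i \<in> A \<Longrightarrow> s i \<in> carrier R"
  shows "f (\<Oplus>i\<in>A. s i) = (\<Oplus>i\<in>A. f (s i))"
  using assms(4)
proof (induction A rule: infinite_finite_induct)
  case (insert x F)
  then have "s \<in> F \<rightarrow> carrier R" "s x \<in> carrier R" "(\<lambda>i. f (s i)) \<in> F \<rightarrow> carrier R"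
    using assms by auto
  then show ?case using insert assms by simp
qed (use assms in auto)

text \<open>Additive maps that respect the filtration are continuous. One-sided multiplications,
  \<open>\<tau>\<close> and \<open>\<delta>\<close> are all of this kind.\<close>

lemma adic_sums_map:
  assumes "\<And>x. x \<in> carrier R \<Longrightarrow> f x \<in> carrier R" "f \<zero> = \<zero>"
    and add: "\<And>x y. x \<in> carrier R \<Longrightarrow> y \<in> carrier R \<Longrightarrow> f (x \<oplus> y) = f x \<oplus> f y"
    and cont: "\<And>x m. x \<in> pw m \<Longrightarrow> f x \<in> pw m"
    and s: "adic_sums s l"
  shows "adic_sums (\<lambda>i. f (s i)) (f l)"
proof -
  have neg: "f (\<ominus> x) = \<ominus> f x" if "x \<in> carrier R" for x
  proof (rule minus_equality[symmetric])
    have "f (\<ominus> x) \<oplus> f x = f (\<ominus> x \<oplus> x)" using that by (simp add: add)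
    then show "f (\<ominus> x) \<oplus> f x = \<zero>" using that assms by (simp add: l_neg)
  qed (use that assms in auto)
  have cong: "adic_cong m (f x) (f y)" if "adic_cong m x y" for m x y
  proof -
    have "f x \<ominus> f y = f (x \<ominus> y)"
      using that by (simp add: adic_cong_def a_minus_def add neg)
    then show ?thesis using that assms by (simp add: adic_cong_def)
  qed
  have "f (\<Oplus>i\<in>{..<r}. s i) = (\<Oplus>i\<in>{..<r}. f (s i))" for r
    using assms adic_sums_term[OF s] by (intro additive_finsum) auto
  then show ?thesis
    using s cong assms unfolding adic_sums_def by metis
qed

lemma adic_sums_l: "adic_sums s l \<Longrightarrow> c \<in> carrier R \<Longrightarrow> adic_sums (\<lambda>i. c \<otimes> s i) (c \<otimes> l)"
  by (rule adic_sums_map[of "\<lambda>x. c \<otimes> x"]) (auto simp: r_distr pw_l)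

lemma adic_sums_r: "adic_sums s l \<Longrightarrow> c \<in> carrier R \<Longrightarrow> adic_sums (\<lambda>i. s i \<otimes> c) (l \<otimes> c)"
  by (rule adic_sums_map[of "\<lambda>x. x \<otimes> c"]) (auto simp: l_distr pw_r)

text \<open>Used where multiplication by \<open>y\<close> moves the coefficient with index
  \<open>i\<close> to index \<open>i + 1\<close>.\<close>

lemma adic_sums_shift:
  assumes "adic_sums s l"
  shows "adic_sums (\<lambda>i. if i = 0 then \<zero> else s (i - 1)) l"
proof -
  have eq: "(\<Oplus>i\<in>{..<Suc q}. if i = 0 then \<zero> else s (i - 1)) = (\<Oplus>i\<in>{..<q}. s i)" for q
  proof (induction q)
    case 0 then show ?case by (simp add: lessThan_Suc)
  next
    case (Suc q)
    then show ?case
      using assms by (subst lessThan_Suc, subst finsum_insert)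
        (auto simp: adic_sums_term lessThan_Suc Pi_def)
  qed
  have "\<exists>p. \<forall>q\<ge>p. adic_cong m (\<Oplus>i\<in>{..<q}. if i = 0 then \<zero> else s (i - 1)) l" for m
  proof -
    obtain p where p: "\<forall>r\<ge>p. adic_cong m (\<Oplus>i\<in>{..<r}. s i) l"
      using adic_sums_ev[OF assms] by meson
    have "adic_cong m (\<Oplus>i\<in>{..<q}. if i = 0 then \<zero> else s (i - 1)) l" if "q \<ge> Suc p" for q
      using p that eq[of "q - 1"] by (cases q) auto
    then show ?thesis by blast
  qed
  then show ?thesis
    using assms by (auto simp: adic_sums_def)
qed

lemma adic_sums_single:
  assumes "x \<in> carrier R"
  shows "adic_sums (\<lambda>i. if i = n then x else \<zero>) x"
proof -
  have "(\<Oplus>i\<in>{..<q}. if i = n then x else \<zero>) = x" if "q > n" for q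
    using finsum_singleton[of n "{..<q}" "\<lambda>i. x"] assms that by (simp add: eq_commute)
  then have "\<forall>q\<ge>Suc n. adic_cong m (\<Oplus>i\<in>{..<q}. if i = n then x else \<zero>) x" for m
    using assms by (simp add: adic_cong_refl)
  then show ?thesis using assms unfolding adic_sums_def by (auto split: if_splits)
qed

text \<open>The two bounds make \<open>t\<close> small outside a finite square, so modulo
  \<open>I^m\<close> both iterated sums equal the same finite double sum. In the application to
  products, the offset \<open>n\<close> is the index of the coefficient being computed.\<close>

lemma adic_double_sum:
  assumes rows: "\<And>i. adic_sums (t i) (u i)" and u: "adic_sums u A"
    and cols: "\<And>k. adic_sums (\<lambda>i. t i k) (v k)" and v: "adic_sums v B"
    and t1: "\<And>i k. t i k \<in> pw (i - n)" and t2: "\<And>i k. t i k \<in> pw (k - n)"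
  shows "A = B"
proof (rule adic_cong_eq)
  fix m
  \<comment> \<open>An index of at least \<open>m + n\<close> still leaves \<open>m\<close> after
    the offset \<open>n\<close> is subtracted.\<close>
  define p where "p = m + n"
  have t1': "t i k \<in> pw m" if "i \<ge> p" for i k
    using t1 pw_antiD that p_def by (metis le_diff_conv2 le_add2 le_trans)
  have t2': "t i k \<in> pw m" if "k \<ge> p" for i k
    using t2 pw_antiD that p_def by (metis le_diff_conv2 le_add2 le_trans)
  have tc: "t i k \<in> carrier R" for i k using t1 pw_carrier by blast
  have "adic_cong m A (\<Oplus>i\<in>{..<p}. u i)"
    using u by (rule adic_sums_tail) (use rows t1' adic_sums_pw in blast)
  also have "adic_cong m (\<Oplus>i\<in>{..<p}. u i) (\<Oplus>i\<in>{..<p}. \<Oplus>k\<in>{..<p}. t i k)"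
    by (intro adic_cong_finsum adic_sums_tail[OF rows] t2')
  also have "(\<Oplus>i\<in>{..<p}. \<Oplus>k\<in>{..<p}. t i k) = (\<Oplus>k\<in>{..<p}. \<Oplus>i\<in>{..<p}. t i k)"
  proof -
    have "(\<Oplus>i\<in>{..<r}. \<Oplus>k\<in>{..<p}. t i k) = (\<Oplus>k\<in>{..<p}. \<Oplus>i\<in>{..<r}. t i k)" for r
    proof (induction r)
      case (Suc r)
      then show ?case
        using tc by (simp add: lessThan_Suc finsum_addf Pi_def)
    qed simp
    then show ?thesis .
  qed
  also have "adic_cong m \<dots> (\<Oplus>k\<in>{..<p}. v k)"
    by (intro adic_cong_finsum adic_cong_sym[OF adic_sums_tail[OF cols]] t1')
  also have "adic_cong m \<dots> B"
    by (rule adic_cong_sym[OF adic_sums_tail[OF v]]) (use cols t2' adic_sums_pw in blast)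
  finally show "adic_cong m A B" .
qed

end

section \<open>The skew power series ring\<close>

locale skew_adic_ring = adic_ring I R for I and R (structure) +
  fixes \<tau> \<delta> :: "'a \<Rightarrow> 'a"
  assumes one_not_zero: "\<one> \<noteq> \<zero>"
    and tau_iso: "\<tau> \<in> ring_iso R R"
    and deriv: "left_skew_derivation R \<tau> \<delta>"
    and tau_I: "\<tau> ` I = I"
    and delta_R: "\<delta> ` carrier R \<subseteq> I"
    and delta_I: "\<delta> ` I \<subseteq> ideal_pow R I 2"
begin

section \<open>The maps \<open>\<tau>\<close> and \<open>\<delta>\<close> on powers of the
  ideal\<close>

lemma tau_hom: "\<tau> \<in> ring_hom R R"
  using tau_iso by (simp add: ring_iso_def)

lemma tau_closed [simp]: "x \<in> carrier R \<Longrightarrow> \<tau> x \<in> carrier R"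
  using tau_hom by (rule ring_hom_closed)

lemma tau_add: "x \<in> carrier R \<Longrightarrow> y \<in> carrier R \<Longrightarrow> \<tau> (x \<oplus> y) = \<tau> x \<oplus> \<tau> y"
  using tau_hom by (rule ring_hom_add)

lemma tau_mult: "x \<in> carrier R \<Longrightarrow> y \<in> carrier R \<Longrightarrow> \<tau> (x \<otimes> y) = \<tau> x \<otimes> \<tau> y"
  using tau_hom by (rule ring_hom_mult)

lemma tau_one [simp]: "\<tau> \<one> = \<one>"
  using tau_hom by (rule ring_hom_one)

lemma tau_zero [simp]: "\<tau> \<zero> = \<zero>"
  using ring_hom_zero[OF tau_hom] ring_axioms by blast

lemma delta_closed [simp]: "x \<in> carrier R \<Longrightarrow> \<delta> x \<in> carrier R"
  using deriv by (auto simp: left_skew_derivation_def)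

lemma delta_add: "x \<in> carrier R \<Longrightarrow> y \<in> carrier R \<Longrightarrow> \<delta> (x \<oplus> y) = \<delta> x \<oplus> \<delta> y"
  using deriv by (auto simp: left_skew_derivation_def)

lemma delta_mult:
  "x \<in> carrier R \<Longrightarrow> y \<in> carrier R \<Longrightarrow> \<delta> (x \<otimes> y) = \<tau> x \<otimes> \<delta> y \<oplus> \<delta> x \<otimes> y"
  using deriv by (auto simp: left_skew_derivation_def)

lemma delta_zero [simp]: "\<delta> \<zero> = \<zero>"
  using delta_add[of \<zero> \<zero>] by (metis delta_closed add.l_cancel_one l_zero zero_closed)

lemma delta_one [simp]: "\<delta> \<one> = \<zero>"
  using delta_mult[of \<one> \<one>] by (simp add: add.l_cancel_one)

lemma tau_pw: "x \<in> pw n \<Longrightarrow> \<tau> x \<in> pw n"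
proof (induction n arbitrary: x)
  case 0
  then show ?case by (simp add: pw_0)
next
  case (Suc n)
  from Suc.prems have "x \<in> ideal_prod R I (pw n)" by (simp add: pw_Suc)
  then show ?case
  proof induction
    case (prod i j)
    have "\<tau> i \<otimes> \<tau> j \<in> pw (Suc n)"
      unfolding pw_Suc using prod tau_I Suc.IH by (intro ideal_prod.prod) auto
    then show ?case using prod pw_carrier by (simp add: tau_mult)
  next
    case (sum s1 s2)
    then show ?case using pw_carrier[of _ "Suc n"] by (simp add: pw_Suc[symmetric] tau_add pw_add)
  qed
qed

text \<open>For \<open>i \<in> I\<close> and \<open>j \<in> I^n\<close>, the term
  \<open>\<tau> i \<delta> j\<close> gains a power through \<open>\<delta> j\<close> by induction,
  and \<open>\<delta> i j\<close> gains one through \<open>\<delta> I \<subseteq> I^2\<close>. This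
  gain is the source of convergence in \<open>T\<close>.\<close>

lemma delta_pw: "x \<in> pw n \<Longrightarrow> \<delta> x \<in> pw (Suc n)"
proof (induction n arbitrary: x)
  case 0
  then show ?case using delta_R pw_1 by (auto simp: pw_0)
next
  case (Suc n)
  from Suc.prems have "x \<in> ideal_prod R I (pw n)" by (simp add: pw_Suc)
  then show ?case
  proof induction
    case (prod i j)
    have "\<tau> i \<in> I" using prod tau_I by blast
    then have "\<tau> i \<otimes> \<delta> j \<in> pw (Suc (Suc n))"
      using prod Suc.IH unfolding pw_Suc[of "Suc n"] by (intro ideal_prod.prod) auto
    moreover have "\<delta> i \<otimes> j \<in> pw (2 + n)"
      using prod delta_I by (intro pw_mult) auto
    ultimately show ?case using prod pw_carrier by (simp add: delta_mult pw_add)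
  next
    case (sum s1 s2)
    then show ?case using pw_carrier[of _ "Suc n"] by (simp add: pw_Suc[of n, symmetric] delta_add pw_add)
  qed
qed

section \<open>Left multiplication by \<open>y\<close>\<close>

abbreviation "Y \<equiv> y_times R \<tau> \<delta>"
abbreviation "S \<equiv> skew_poly R \<tau> \<delta>"
abbreviation "T \<equiv> skew_power_series R I \<tau> \<delta>"

lemma carrier_T: "f \<in> carrier T \<longleftrightarrow> (\<forall>n. f n \<in> carrier R)"
  by (auto simp: skew_power_series_def)

lemma T_coeff: "f \<in> carrier T \<Longrightarrow> f n \<in> carrier R"
  by (simp add: carrier_T)

lemma add_T [simp]: "(f \<oplus>\<^bsub>T\<^esub> g) n = f n \<oplus> g n"
  by (simp add: skew_power_series_def)

lemma zero_T [simp]: "\<zero>\<^bsub>T\<^esub> n = \<zero>"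
  by (simp add: skew_power_series_def)

lemma one_T: "\<one>\<^bsub>T\<^esub> = const_series R \<one>"
  by (simp add: skew_power_series_def)

lemma monomial_T [simp]: "r \<in> carrier R \<Longrightarrow> monomial R r i \<in> carrier T"
  by (simp add: carrier_T monomial_def)

lemma Y_0: "Y f 0 = \<zero> \<oplus> \<delta> (f 0)"
  by (simp add: y_times_def)

lemma Y_Suc: "Y f (Suc n) = \<tau> (f n) \<oplus> \<delta> (f (Suc n))"
  by (simp add: y_times_def)

lemma Y_closed: "f \<in> carrier T \<Longrightarrow> Y f \<in> carrier T"
  by (auto simp: carrier_T y_times_def)

lemma Y_pow_closed: "f \<in> carrier T \<Longrightarrow> (Y ^^ i) f \<in> carrier T"
  by (induction i) (auto simp: Y_closed)

lemma Y_pow_coeff [simp]: "f \<in> carrier T \<Longrightarrow> (Y ^^ i) f n \<in> carrier R"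
  using Y_pow_closed T_coeff by blast

lemma Y_add: "f \<in> carrier T \<Longrightarrow> g \<in> carrier T \<Longrightarrow> Y (f \<oplus>\<^bsub>T\<^esub> g) = Y f \<oplus>\<^bsub>T\<^esub> Y g"
  by (rule ext) (auto simp: y_times_def carrier_T tau_add delta_add a_ac)

lemma add_T_closed: "f \<in> carrier T \<Longrightarrow> g \<in> carrier T \<Longrightarrow> f \<oplus>\<^bsub>T\<^esub> g \<in> carrier T"
  by (auto simp: carrier_T)

lemma Y_pow_add:
  "f \<in> carrier T \<Longrightarrow> g \<in> carrier T \<Longrightarrow> (Y ^^ i) (f \<oplus>\<^bsub>T\<^esub> g) = (Y ^^ i) f \<oplus>\<^bsub>T\<^esub> (Y ^^ i) g"
  by (induction i) (auto simp: Y_add Y_pow_closed)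

lemma Y_monomial_one: "Y (monomial R \<one> i) = monomial R \<one> (Suc i)"
  by (rule ext) (auto simp: y_times_def monomial_def)

lemma Y_pow_one: "(Y ^^ i) (const_series R \<one>) = monomial R \<one> i"
  by (induction i) (auto simp: Y_monomial_one)

text \<open>Each of the \<open>i\<close> factors \<open>y\<close> raises either the exponent,
  through \<open>\<tau>\<close>, or the power of \<open>I\<close>, through \<open>\<delta>\<close>.
  At coefficient \<open>n\<close> at most \<open>n\<close> of them did the former, so at least
  \<open>i - n\<close> did the latter.\<close>

lemma Y_pow_pw:
  assumes f: "f \<in> carrier T"
  shows "(Y ^^ i) f n \<in> pw (i - n)"
proof (induction i arbitrary: n)
  case 0
  then show ?case using f by (simp add: pw_0 carrier_T)
next
  case (Suc i)
  \<comment> \<open>Only \<open>Suc i - n \<le> Suc (i - n)\<close> is available, because the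
    difference is truncated for \<open>n > i\<close>.\<close>
  have d: "\<delta> ((Y ^^ i) f n) \<in> pw (Suc i - n)"
    by (rule pw_antiD[OF delta_pw[OF Suc.IH]]) simp
  show ?case
  proof (cases n)
    case 0
    then show ?thesis using d f by (simp add: Y_0)
  next
    case (Suc k)
    then show ?thesis using d tau_pw[OF Suc.IH[of k]] by (simp add: Y_Suc pw_add)
  qed
qed

lemma skew_y_power: "skew_y R [^]\<^bsub>S\<^esub> (i::nat) = monomial R \<one> i"
proof (induction i)
  case 0
  then show ?case by (simp add: nat_pow_def skew_poly_def)
next
  case (Suc i)
  \<comment> \<open>Since \<open>\<one> \<noteq> \<zero>\<close>, the support is a single index, and
    the finite sum defining the product of polynomials reduces to the \<open>i\<close>-th iterate of
    \<open>Y\<close>.\<close>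
  have supp: "{j. monomial R \<one> i j \<noteq> \<zero>} = {i}"
    using one_not_zero by (auto simp: monomial_def)
  have "skew_y R [^]\<^bsub>S\<^esub> Suc i = monomial R \<one> i \<otimes>\<^bsub>S\<^esub> skew_y R"
    using Suc by (simp add: nat_pow_def)
  also have "\<dots> = (Y ^^ i) (skew_y R)"
    unfolding skew_poly_def monoid.simps supp
    by (rule ext) (simp add: monomial_def[of R "\<one>" i] Pi_def)
  also have "\<dots> = (Y ^^ Suc i) (const_series R \<one>)"
    using Y_monomial_one[of 0] by (simp del: funpow.simps add: funpow_Suc_right)
  finally show ?case by (simp only: Y_pow_one)
qed

lemma skew_theta_eq: "r \<in> carrier R \<Longrightarrow> skew_theta R \<tau> \<delta> i k r = (Y ^^ i) (const_series R r) k"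
proof -
  assume r: "r \<in> carrier R"
  have supp: "{j. monomial R \<one> i j \<noteq> \<zero>} = {i}"
    using one_not_zero by (auto simp: monomial_def)
  show ?thesis
    unfolding skew_theta_def skew_y_power
    unfolding skew_poly_def monoid.simps supp
    using r by (simp add: monomial_def[of R "\<one>" i] Pi_def)
qed

text \<open>The factor \<open>y^j\<close> in \<open>y^i (b j y^j)\<close> stands on the right, so
  this term is \<open>y^i (b j)\<close> shifted by \<open>j\<close>. Only \<open>j \<le> n\<close>
  reach coefficient \<open>n\<close>, which keeps the sum finite for an infinite series
  \<open>b\<close>.\<close>

lemma Y_pow_eq_sum:
  assumes b: "b \<in> carrier T"
  shows "(Y ^^ i) b n = (\<Oplus>j\<in>{..n}. (Y ^^ i) (const_series R (b j)) (n - j))"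
proof (induction i arbitrary: n)
  case 0
  have "(\<Oplus>j\<in>{..n}. const_series R (b j) (n - j)) = (\<Oplus>j\<in>{..n}. if n = j then b j else \<zero>)"
    using b by (intro finsum_cong') (auto simp: monomial_def carrier_T)
  also have "\<dots> = b n"
    using b by (intro finsum_singleton) (auto simp: carrier_T)
  finally show ?case by simp
next
  case (Suc i)
  define t where "t j k = (Y ^^ i) (const_series R (b j)) k" for j k
  have t: "t j k \<in> carrier R" for j k
    using b by (simp add: t_def T_coeff)
  have IH: "(Y ^^ i) b n = (\<Oplus>j\<in>{..n}. t j (n - j))" for n
    using Suc.IH by (simp add: t_def)
  have d: "\<delta> (\<Oplus>j\<in>{..n}. t j (n - j)) = (\<Oplus>j\<in>{..n}. \<delta> (t j (n - j)))" for n
    using t by (intro additive_finsum) (auto simp: delta_add)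
  have tau: "\<tau> (\<Oplus>j\<in>{..n}. t j (n - j)) = (\<Oplus>j\<in>{..n}. \<tau> (t j (n - j)))" for n
    using t by (intro additive_finsum) (auto simp: tau_add)
  show ?case
  proof (cases n)
    case 0
    then show ?thesis using IH[of 0] t by (simp add: Y_0 t_def[symmetric])
  next
    case (Suc k)
    \<comment> \<open>For \<open>j = n\<close> the coefficient sits at index \<open>0\<close>, where
      \<open>Y\<close> has no \<open>\<tau>\<close> part. The remaining \<open>\<tau>\<close> terms
      are exactly those of coefficient \<open>k = n - 1\<close>.\<close>
    have "(\<Oplus>j\<in>{..n}. Y (t j) (n - j))
        = (\<Oplus>j\<in>{..n}. (if j = n then \<zero> else \<tau> (t j (k - j))) \<oplus> \<delta> (t j (n - j)))"
      using t Suc by (intro finsum_cong') (auto simp: y_times_def)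
    also have "\<dots> = (\<Oplus>j\<in>{..n}. (if j = n then \<zero> else \<tau> (t j (k - j)))) \<oplus> (\<Oplus>j\<in>{..n}. \<delta> (t j (n - j)))"
      using t by (intro finsum_addf) auto
    also have "(\<Oplus>j\<in>{..n}. (if j = n then \<zero> else \<tau> (t j (k - j)))) = (\<Oplus>j\<in>{..k}. \<tau> (t j (k - j)))"
    proof -
      have "(\<Oplus>j\<in>{..k}. (if j = n then \<zero> else \<tau> (t j (k - j)))) = (\<Oplus>j\<in>{..k}. \<tau> (t j (k - j)))"
        using t Suc by (intro finsum_cong') auto
      then show ?thesis using Suc t by (subst Suc, subst finsum_Suc) auto
    qed
    finally have "(\<Oplus>j\<in>{..n}. Y (t j) (n - j)) = \<tau> ((Y ^^ i) b k) \<oplus> \<delta> ((Y ^^ i) b n)"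
      by (simp add: IH d tau)
    then show ?thesis
      using Suc by (simp add: t_def[abs_def] Y_Suc)
  qed
qed

lemma sums_mult_exists:
  assumes "a \<in> carrier T" "b \<in> carrier T"
  shows "\<exists>l. adic_sums (\<lambda>i. a i \<otimes> (Y ^^ i) b n) l"
proof (rule adic_sums_exists)
  fix m
  have "a i \<otimes> (Y ^^ i) b n \<in> pw m" if "i \<ge> m + n" for i
    using that assms pw_antiD[OF Y_pow_pw, of b m i n] by (intro pw_l) (auto simp: T_coeff)
  then show "\<exists>p. \<forall>i\<ge>p. a i \<otimes> (Y ^^ i) b n \<in> pw m" by blast
qed (use assms in \<open>auto simp: T_coeff\<close>)

text \<open>The definition sums over \<open>i\<close> inside and over \<open>j \<le> n\<close>
  outside. The outer sum is finite, so it can be moved inside the limit, where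
  \<open>Y_pow_eq_sum\<close> collapses it.\<close>

lemma sums_mult_T:
  assumes a: "a \<in> carrier T" and b: "b \<in> carrier T"
  shows "adic_sums (\<lambda>i. a i \<otimes> (Y ^^ i) b n) ((a \<otimes>\<^bsub>T\<^esub> b) n)"
proof -
  let ?t = "\<lambda>j i. a i \<otimes> (Y ^^ i) (const_series R (b j)) (n - j)"
  have cb: "const_series R (b j) \<in> carrier T" for j using b by (simp add: T_coeff)
  have "\<exists>l. adic_sums (?t j) l" for j
    using sums_mult_exists[OF a cb] .
  then obtain l where l: "adic_sums (?t j) (l j)" for j by metis
  have "(a \<otimes>\<^bsub>T\<^esub> b) n = (\<Oplus>j\<in>{..n}. adic_suminf R I (?t j))"
    unfolding skew_power_series_def using b by (simp add: skew_theta_eq T_coeff)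
  also have "\<dots> = (\<Oplus>j\<in>{..n}. l j)"
    using adic_sums_suminf[OF l] by simp
  finally have "adic_sums (\<lambda>i. \<Oplus>j\<in>{..n}. ?t j i) ((a \<otimes>\<^bsub>T\<^esub> b) n)"
    using adic_sums_finsum[of "{..n}" ?t l] l by simp
  moreover have "(\<Oplus>j\<in>{..n}. ?t j i) = a i \<otimes> (Y ^^ i) b n" for i
    unfolding Y_pow_eq_sum[OF b]
    using a cb by (intro finsum_rdistr[symmetric]) (auto simp: T_coeff)
  ultimately show ?thesis by simp
qed

lemma mult_T_eqI:
  assumes "a \<in> carrier T" "b \<in> carrier T" "\<And>n. adic_sums (\<lambda>i. a i \<otimes> (Y ^^ i) b n) (c n)"
  shows "a \<otimes>\<^bsub>T\<^esub> b = c"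
  by (rule ext) (rule adic_sums_unique[OF sums_mult_T[OF assms(1,2)] assms(3)])

lemma mult_T_closed: "a \<in> carrier T \<Longrightarrow> b \<in> carrier T \<Longrightarrow> a \<otimes>\<^bsub>T\<^esub> b \<in> carrier T"
  unfolding carrier_T[of "a \<otimes>\<^bsub>T\<^esub> b"] by (blast intro: adic_sums_carrier sums_mult_T)

lemma const_mult:
  assumes "r \<in> carrier R" "f \<in> carrier T"
  shows "const_series R r \<otimes>\<^bsub>T\<^esub> f = (\<lambda>n. r \<otimes> f n)"
proof (rule mult_T_eqI)
  fix n
  have "adic_sums (\<lambda>i. if i = 0 then r \<otimes> f n else \<zero>) (r \<otimes> f n)"
    using assms by (intro adic_sums_single) (simp add: T_coeff)
  moreover have "(\<lambda>i. const_series R r i \<otimes> (Y ^^ i) f n) = (\<lambda>i. if i = 0 then r \<otimes> f n else \<zero>)"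
    using assms by (auto simp: monomial_def fun_eq_iff)
  ultimately show "adic_sums (\<lambda>i. const_series R r i \<otimes> (Y ^^ i) f n) (r \<otimes> f n)" by simp
qed (use assms in auto)

lemma mult_one_T:
  assumes f: "f \<in> carrier T"
  shows "f \<otimes>\<^bsub>T\<^esub> \<one>\<^bsub>T\<^esub> = f"
  unfolding one_T
proof (rule mult_T_eqI)
  fix n
  have "(\<lambda>i. f i \<otimes> (Y ^^ i) (const_series R \<one>) n) = (\<lambda>i. if i = n then f n else \<zero>)"
    unfolding Y_pow_one using f by (auto simp: monomial_def fun_eq_iff T_coeff)
  then show "adic_sums (\<lambda>i. f i \<otimes> (Y ^^ i) (const_series R \<one>) n) (f n)"
    using f by (simp add: adic_sums_single T_coeff)
qed (use f in auto)

lemma one_mult_T: "f \<in> carrier T \<Longrightarrow> \<one>\<^bsub>T\<^esub> \<otimes>\<^bsub>T\<^esub> f = f"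
  by (simp add: one_T const_mult T_coeff)

lemma l_distr_T:
  assumes "a \<in> carrier T" "b \<in> carrier T" "c \<in> carrier T"
  shows "(a \<oplus>\<^bsub>T\<^esub> b) \<otimes>\<^bsub>T\<^esub> c = a \<otimes>\<^bsub>T\<^esub> c \<oplus>\<^bsub>T\<^esub> b \<otimes>\<^bsub>T\<^esub> c"
proof (rule mult_T_eqI)
  fix n
  show "adic_sums (\<lambda>i. (a \<oplus>\<^bsub>T\<^esub> b) i \<otimes> (Y ^^ i) c n) ((a \<otimes>\<^bsub>T\<^esub> c \<oplus>\<^bsub>T\<^esub> b \<otimes>\<^bsub>T\<^esub> c) n)"
    using adic_sums_add[OF sums_mult_T[of a c n] sums_mult_T[of b c n]] assms
    by (simp add: l_distr T_coeff)
qed (use assms in \<open>auto simp: add_T_closed\<close>)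

lemma r_distr_T:
  assumes "a \<in> carrier T" "b \<in> carrier T" "c \<in> carrier T"
  shows "c \<otimes>\<^bsub>T\<^esub> (a \<oplus>\<^bsub>T\<^esub> b) = c \<otimes>\<^bsub>T\<^esub> a \<oplus>\<^bsub>T\<^esub> c \<otimes>\<^bsub>T\<^esub> b"
proof (rule mult_T_eqI)
  fix n
  show "adic_sums (\<lambda>i. c i \<otimes> (Y ^^ i) (a \<oplus>\<^bsub>T\<^esub> b) n) ((c \<otimes>\<^bsub>T\<^esub> a \<oplus>\<^bsub>T\<^esub> c \<otimes>\<^bsub>T\<^esub> b) n)"
    using adic_sums_add[OF sums_mult_T[of c a n] sums_mult_T[of c b n]] assms
    by (simp add: r_distr T_coeff Y_pow_add)
qed (use assms in \<open>auto simp: add_T_closed\<close>)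

text \<open>Together with the double sum lemma this gives associativity: \<open>Y\<^sup>i (b c) = (Y\<^sup>i b) c\<close>.\<close>

lemma Y_mult:
  assumes b: "b \<in> carrier T" and c: "c \<in> carrier T"
  shows "Y (b \<otimes>\<^bsub>T\<^esub> c) = Y b \<otimes>\<^bsub>T\<^esub> c"
proof (rule mult_T_eqI[symmetric])
  fix n
  let ?s = "\<lambda>n i. b i \<otimes> (Y ^^ i) c n"
  have st: "?s n i \<in> carrier R" for n i using b c by (simp add: T_coeff)
  have del: "adic_sums (\<lambda>i. \<delta> (?s n i)) (\<delta> ((b \<otimes>\<^bsub>T\<^esub> c) n))"
    by (rule adic_sums_map[OF _ _ _ _ sums_mult_T[OF b c]])
      (auto simp: delta_add intro: pw_antiD[OF delta_pw])
  have tau: "adic_sums (\<lambda>i. \<tau> (?s k i)) (\<tau> ((b \<otimes>\<^bsub>T\<^esub> c) k))" for k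
    by (rule adic_sums_map[OF _ _ _ _ sums_mult_T[OF b c]]) (auto simp: tau_add tau_pw)
  \<comment> \<open>The twisted Leibniz rule splits \<open>\<delta> (b i (Y^i c) n)\<close>. With
    the \<open>\<tau>\<close> term added, the part with left factor \<open>\<tau> (b i)\<close>
    becomes \<open>\<tau> (b i) (Y^(i+1) c) n\<close>, which is \<open>u i\<close>; the part with
    left factor \<open>\<delta> (b i)\<close> is \<open>v i\<close>.\<close>
  define u where "u i = (if n = 0 then \<zero> else \<tau> (?s (n - 1) i)) \<oplus> \<tau> (b i) \<otimes> \<delta> ((Y ^^ i) c n)" for i
  define v where "v i = \<delta> (b i) \<otimes> (Y ^^ i) c n" for i
  have uv: "u i \<in> carrier R" "v i \<in> carrier R" for i
    using b c by (auto simp: u_def v_def T_coeff)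
  have u_eq: "u i = \<tau> (b i) \<otimes> (Y ^^ Suc i) c n" for i
    using b c by (auto simp: u_def y_times_def tau_mult r_distr T_coeff)
  have "adic_sums (\<lambda>i. (if n = 0 then \<zero> else \<tau> (?s (n - 1) i)) \<oplus> \<delta> (?s n i)) (Y (b \<otimes>\<^bsub>T\<^esub> c) n)"
    unfolding y_times_def[of R \<tau> \<delta> "b \<otimes>\<^bsub>T\<^esub> c"]
    using adic_sums_add[OF _ del, of "\<lambda>i. \<zero>" \<zero>] adic_sums_add[OF tau[of "n - 1"] del] adic_sums_zero
    by (cases "n = 0") auto
  moreover have "(if n = 0 then \<zero> else \<tau> (?s (n - 1) i)) \<oplus> \<delta> (?s n i) = u i \<oplus> v i" for i
    using b c by (simp add: u_def v_def T_coeff delta_mult a_assoc)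
  ultimately have sum: "adic_sums (\<lambda>i. u i \<oplus> v i) (Y (b \<otimes>\<^bsub>T\<^esub> c) n)" by simp
  \<comment> \<open>The sums of \<open>u\<close> and \<open>v\<close> need separate limits, because
    only \<open>u\<close> is shifted by one place to match
    \<open>Y b i = \<tau> (b (i - 1)) + \<delta> (b i)\<close>.\<close>
  have "\<exists>l. adic_sums v l"
    unfolding v_def
    using sums_mult_exists[of "\<lambda>i. \<delta> (b i)" c n] b c by (simp add: carrier_T)
  then obtain l where l: "adic_sums v l" by blast
  have "\<exists>k. adic_sums u k"
  proof (rule adic_sums_exists)
    fix m
    have "u i \<in> pw m" if "i \<ge> m + n" for i
      unfolding u_eq using that b c pw_antiD[OF Y_pow_pw, of c m "Suc i" n]
      by (intro pw_l) (auto simp: T_coeff)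
    then show "\<exists>p. \<forall>i\<ge>p. u i \<in> pw m" by blast
  qed (rule uv)
  then obtain k where k: "adic_sums u k" by blast
  have kl: "Y (b \<otimes>\<^bsub>T\<^esub> c) n = k \<oplus> l"
    using adic_sums_unique[OF sum adic_sums_add[OF k l]] .
  have "adic_sums (\<lambda>i. (if i = 0 then \<zero> else u (i - 1)) \<oplus> v i) (k \<oplus> l)"
    by (rule adic_sums_add[OF adic_sums_shift[OF k] l])
  moreover have "(if i = 0 then \<zero> else u (i - 1)) \<oplus> v i = Y b i \<otimes> (Y ^^ i) c n" for i
    using b c Y_pow_coeff[OF c, of i n] unfolding u_eq
    by (cases i) (auto simp: v_def Y_0 Y_Suc l_distr T_coeff simp del: funpow.simps)
  ultimately show "adic_sums (\<lambda>i. Y b i \<otimes> (Y ^^ i) c n) (Y (b \<otimes>\<^bsub>T\<^esub> c) n)"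
    by (simp add: kl)
qed (use b c in \<open>auto simp: Y_closed\<close>)

lemma Y_pow_mult:
  "b \<in> carrier T \<Longrightarrow> c \<in> carrier T \<Longrightarrow> (Y ^^ i) (b \<otimes>\<^bsub>T\<^esub> c) = (Y ^^ i) b \<otimes>\<^bsub>T\<^esub> c"
  by (induction i) (auto simp: Y_mult Y_pow_closed)

lemma m_assoc_T:
  assumes a: "a \<in> carrier T" and b: "b \<in> carrier T" and c: "c \<in> carrier T"
  shows "(a \<otimes>\<^bsub>T\<^esub> b) \<otimes>\<^bsub>T\<^esub> c = a \<otimes>\<^bsub>T\<^esub> (b \<otimes>\<^bsub>T\<^esub> c)"
proof
  fix n
  let ?t = "\<lambda>i k. a i \<otimes> ((Y ^^ i) b k \<otimes> (Y ^^ k) c n)"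
  show "((a \<otimes>\<^bsub>T\<^esub> b) \<otimes>\<^bsub>T\<^esub> c) n = (a \<otimes>\<^bsub>T\<^esub> (b \<otimes>\<^bsub>T\<^esub> c)) n"
  proof (rule adic_double_sum[symmetric])
    show "adic_sums (?t i) (a i \<otimes> (Y ^^ i) (b \<otimes>\<^bsub>T\<^esub> c) n)" for i
      unfolding Y_pow_mult[OF b c]
      using a b c by (intro adic_sums_l sums_mult_T Y_pow_closed T_coeff)
    show "adic_sums (\<lambda>i. a i \<otimes> (Y ^^ i) (b \<otimes>\<^bsub>T\<^esub> c) n) ((a \<otimes>\<^bsub>T\<^esub> (b \<otimes>\<^bsub>T\<^esub> c)) n)"
      using a b c by (intro sums_mult_T mult_T_closed)
    show "adic_sums (\<lambda>i. ?t i k) ((a \<otimes>\<^bsub>T\<^esub> b) k \<otimes> (Y ^^ k) c n)" for k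
      using a b c adic_sums_r[OF sums_mult_T[OF a b, of k], of "(Y ^^ k) c n"]
      by (simp add: m_assoc T_coeff)
    show "adic_sums (\<lambda>k. (a \<otimes>\<^bsub>T\<^esub> b) k \<otimes> (Y ^^ k) c n) (((a \<otimes>\<^bsub>T\<^esub> b) \<otimes>\<^bsub>T\<^esub> c) n)"
      using a b c by (intro sums_mult_T mult_T_closed)
    show "?t i k \<in> pw (k - n)" for i k
      using a b c by (intro pw_l Y_pow_pw) (auto simp: T_coeff)
    show "?t i k \<in> pw (i - n)" for i k
    proof -
      \<comment> \<open>Truncation is harmless: \<open>(i - k) + (k - n) \<ge> i - n\<close> holds
        also for \<open>k > i\<close> and for \<open>k < n\<close>.\<close>
      have "(Y ^^ i) b k \<otimes> (Y ^^ k) c n \<in> pw ((i - k) + (k - n))"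
        using b c by (intro pw_mult Y_pow_pw)
      then have "(Y ^^ i) b k \<otimes> (Y ^^ k) c n \<in> pw (i - n)"
        by (rule pw_antiD) simp
      then show ?thesis by (rule pw_l) (rule T_coeff[OF a])
    qed
  qed
qed

lemma ring_T: "ring T"
proof (rule ringI)
  show "abelian_group T"
  proof (rule abelian_groupI)
    fix x assume x: "x \<in> carrier T"
    have "(\<lambda>n. \<ominus> x n) \<in> carrier T" "(\<lambda>n. \<ominus> x n) \<oplus>\<^bsub>T\<^esub> x = \<zero>\<^bsub>T\<^esub>"
      using x by (auto simp: carrier_T fun_eq_iff l_neg)
    then show "\<exists>y\<in>carrier T. y \<oplus>\<^bsub>T\<^esub> x = \<zero>\<^bsub>T\<^esub>" by blast
  qed (auto simp: carrier_T fun_eq_iff a_ac)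
  show "monoid T"
    by (rule monoidI) (simp_all add: mult_T_closed m_assoc_T one_mult_T mult_one_T, simp add: one_T)
qed (auto simp: l_distr_T r_distr_T)

end

section \<open>Right ideals and the associated graded ring\<close>

context adic_ring
begin

section \<open>Arithmetic of the graded ring on representatives\<close>

abbreviation "G \<equiv> gr_ring R I"

text \<open>Handling elements of \<open>gr R\<close> through representatives in \<open>R\<close>
  confines coset arithmetic to a few rules such as \<open>gr_class_add\<close> and
  \<open>gr_class_mult\<close>. Finiteness is a condition on classes: an entry in
  \<open>I^(n+1)\<close> counts as zero.\<close>

definition homogeneous_seq :: "(nat \<Rightarrow> 'a) \<Rightarrow> bool" where
  "homogeneous_seq x \<longleftrightarrow> (\<forall>n. x n \<in> pw n) \<and> finite {n. x n \<notin> pw (Suc n)}"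

definition gr_class :: "(nat \<Rightarrow> 'a) \<Rightarrow> nat \<Rightarrow> 'a set" where
  "gr_class x = (\<lambda>n. pw (Suc n) +> x n)"

lemma coset_eq_iff:
  "x \<in> carrier R \<Longrightarrow> pw n +> x = pw n \<longleftrightarrow> x \<in> pw n"
  using ideal.rcos_const_imp_mem[OF pw_ideal] a_rcos_zero[OF pw_ideal] by blast

lemma carrier_G: "f \<in> carrier G \<longleftrightarrow> (\<exists>x. homogeneous_seq x \<and> f = gr_class x)"
proof
  assume "f \<in> carrier G"
  then have 1: "\<forall>n. \<exists>x\<in>pw n. f n = pw (Suc n) +> x" and 2: "finite {n. f n \<noteq> pw (Suc n)}"
    by (auto simp: gr_ring_def)
  from 1 obtain x where x: "\<And>n. x n \<in> pw n" "\<And>n. f n = pw (Suc n) +> x n" by metis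
  have "{n. x n \<notin> pw (Suc n)} = {n. f n \<noteq> pw (Suc n)}"
    unfolding x(2) coset_eq_iff[OF pw_carrier[OF x(1)]] ..
  then show "\<exists>x. homogeneous_seq x \<and> f = gr_class x"
    using x 2 by (intro exI[of _ x]) (auto simp: homogeneous_seq_def gr_class_def)
next
  assume "\<exists>x. homogeneous_seq x \<and> f = gr_class x"
  then obtain x where x: "\<And>n. x n \<in> pw n" "finite {n. x n \<notin> pw (Suc n)}" "f = gr_class x"
    by (auto simp: homogeneous_seq_def)
  have "{n. x n \<notin> pw (Suc n)} = {n. f n \<noteq> pw (Suc n)}"
    unfolding x(3) gr_class_def coset_eq_iff[OF pw_carrier[OF x(1)]] ..
  then show "f \<in> carrier G"
    using x by (auto simp: gr_ring_def gr_class_def)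
qed

lemma gr_class_carrier: "homogeneous_seq x \<Longrightarrow> gr_class x \<in> carrier G"
  using carrier_G by blast

lemma homogeneous_seqD: "homogeneous_seq x \<Longrightarrow> x n \<in> pw n" "homogeneous_seq x \<Longrightarrow> x n \<in> carrier R"
  using pw_carrier by (auto simp: homogeneous_seq_def)

lemma gr_class_add:
  assumes "homogeneous_seq x" "homogeneous_seq y"
  shows "gr_class x \<oplus>\<^bsub>G\<^esub> gr_class y = gr_class (\<lambda>n. x n \<oplus> y n)"
  using assms ideal.a_rcos_sum[OF pw_ideal]
  by (simp add: gr_ring_def gr_class_def homogeneous_seqD fun_eq_iff)

lemma homogeneous_seq_add:
  assumes "homogeneous_seq x" "homogeneous_seq y"
  shows "homogeneous_seq (\<lambda>n. x n \<oplus> y n)"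
proof -
  have "{n. x n \<oplus> y n \<notin> pw (Suc n)} \<subseteq> {n. x n \<notin> pw (Suc n)} \<union> {n. y n \<notin> pw (Suc n)}"
    using pw_add by blast
  then show ?thesis
    using assms pw_add finite_subset unfolding homogeneous_seq_def by (metis (no_types, lifting) finite_UnI)
qed

lemma homogeneous_seq_neg:
  assumes "homogeneous_seq x" shows "homogeneous_seq (\<lambda>n. \<ominus> x n)"
proof -
  have "{n. \<ominus> x n \<notin> pw (Suc n)} \<subseteq> {n. x n \<notin> pw (Suc n)}"
    using pw_neg by blast
  then show ?thesis
    using assms pw_neg finite_subset unfolding homogeneous_seq_def by blast
qed

lemma homogeneous_seq_zero: "homogeneous_seq (\<lambda>n. \<zero>)"
  by (simp add: homogeneous_seq_def)

lemma gr_class_zero: "\<zero>\<^bsub>G\<^esub> = gr_class (\<lambda>n. \<zero>)"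
  using a_rcos_zero[OF pw_ideal pw_zero] by (simp add: gr_ring_def gr_class_def)

lemma gr_class_neg:
  assumes "homogeneous_seq x"
  shows "gr_class (\<lambda>n. \<ominus> x n) \<oplus>\<^bsub>G\<^esub> gr_class x = \<zero>\<^bsub>G\<^esub>"
  using assms by (simp add: gr_class_add homogeneous_seq_neg gr_class_zero homogeneous_seqD l_neg)

lemma abelian_group_G: "abelian_group G"
proof (rule abelian_groupI)
  fix f assume "f \<in> carrier G"
  then obtain x where x: "homogeneous_seq x" "f = gr_class x" using carrier_G by blast
  show "\<zero>\<^bsub>G\<^esub> \<oplus>\<^bsub>G\<^esub> f = f"
    using x by (simp add: gr_class_zero gr_class_add homogeneous_seq_zero homogeneous_seqD)
  show "\<exists>g\<in>carrier G. g \<oplus>\<^bsub>G\<^esub> f = \<zero>\<^bsub>G\<^esub>"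
    using x gr_class_neg gr_class_carrier homogeneous_seq_neg by blast
  fix g assume "g \<in> carrier G"
  then obtain y where y: "homogeneous_seq y" "g = gr_class y" using carrier_G by blast
  show "f \<oplus>\<^bsub>G\<^esub> g \<in> carrier G"
    using x y by (simp add: gr_class_add gr_class_carrier homogeneous_seq_add)
  show "f \<oplus>\<^bsub>G\<^esub> g = g \<oplus>\<^bsub>G\<^esub> f"
    using x y by (simp add: gr_class_add homogeneous_seqD a_comm)
  fix h assume "h \<in> carrier G"
  then obtain z where z: "homogeneous_seq z" "h = gr_class z" using carrier_G by blast
  show "f \<oplus>\<^bsub>G\<^esub> g \<oplus>\<^bsub>G\<^esub> h = f \<oplus>\<^bsub>G\<^esub> (g \<oplus>\<^bsub>G\<^esub> h)"
    using x y z by (simp add: gr_class_add homogeneous_seq_add homogeneous_seqD a_assoc)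
next
  show "\<zero>\<^bsub>G\<^esub> \<in> carrier G"
    by (simp add: gr_class_zero gr_class_carrier homogeneous_seq_zero)
qed

text \<open>\<open>rcoset_mult\<close> is a union over all pairs of representatives. Changing
  \<open>x\<close> and \<open>y\<close> by elements one power higher changes \<open>x y\<close> only
  within \<open>I^(n+1)\<close>, so all members of the union coincide.\<close>

lemma rcoset_mult_pw:
  assumes x: "x \<in> pw k" and y: "y \<in> pw l" and n: "n = k + l"
  shows "rcoset_mult R (pw (Suc n)) (pw (Suc k) +> x) (pw (Suc l) +> y) = pw (Suc n) +> (x \<otimes> y)"
proof -
  have "pw (Suc n) +> ((u \<oplus> x) \<otimes> (v \<oplus> y)) = pw (Suc n) +> (x \<otimes> y)"
    if u: "u \<in> pw (Suc k)" and v: "v \<in> pw (Suc l)" for u v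
  proof -
    have c: "u \<in> carrier R" "v \<in> carrier R" "x \<in> carrier R" "y \<in> carrier R"
      using u v x y pw_carrier by auto
    have "(u \<oplus> x) \<otimes> (v \<oplus> y) \<ominus> x \<otimes> y = u \<otimes> v \<oplus> u \<otimes> y \<oplus> x \<otimes> v"
      using c by algebra
    moreover have "u \<otimes> v \<in> pw (Suc n)"
      using pw_mult[OF u v] by (rule pw_antiD) (simp add: n)
    moreover have "u \<otimes> y \<in> pw (Suc n)"
      using pw_mult[OF u y] by (rule pw_antiD) (simp add: n)
    moreover have "x \<otimes> v \<in> pw (Suc n)"
      using pw_mult[OF x v] by (rule pw_antiD) (simp add: n)
    ultimately have m: "(u \<oplus> x) \<otimes> (v \<oplus> y) \<ominus> x \<otimes> y \<in> pw (Suc n)"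
      by (simp add: pw_add)
    interpret P: ideal "pw (Suc n)" R by (rule pw_ideal)
    have "(u \<oplus> x) \<otimes> (v \<oplus> y) \<in> pw (Suc n) +> (x \<otimes> y)"
      using P.a_rcos_module_minus m c ring_axioms by simp
    then show ?thesis
      using P.a_repr_independence' c by simp
  qed
  moreover have pw_ne: "pw m \<noteq> {}" for m using pw_zero by blast
  ultimately show ?thesis
    unfolding rcoset_mult_def a_r_coset_def'[of R "pw (Suc k)"] a_r_coset_def'[of R "pw (Suc l)"]
    using pw_ne[of "Suc k"] pw_ne[of "Suc l"] by auto
qed

lemma gr_class_mult:
  assumes x: "homogeneous_seq x" and y: "homogeneous_seq y"
  shows "gr_class x \<otimes>\<^bsub>G\<^esub> gr_class y = gr_class (\<lambda>n. \<Oplus>k\<in>{..n}. x k \<otimes> y (n - k))"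
proof
  fix n
  interpret P: ideal "pw (Suc n)" R by (rule pw_ideal)
  interpret H: ring_hom_ring R "R Quot pw (Suc n)" "(+>) (pw (Suc n))" by (rule P.rcos_ring_hom_ring)
  have c: "x k \<otimes> y (n - k) \<in> carrier R" for k using x y by (simp add: homogeneous_seqD)
  have "rcoset_mult R (pw (Suc n)) (gr_class x k) (gr_class y (n - k)) = pw (Suc n) +> (x k \<otimes> y (n - k))"
    if "k \<le> n" for k
    using rcoset_mult_pw[of "x k" k "y (n - k)" "n - k" n] that x y
    by (simp add: gr_class_def homogeneous_seqD)
  then have "(gr_class x \<otimes>\<^bsub>G\<^esub> gr_class y) n
      = (\<Oplus>\<^bsub>R Quot pw (Suc n)\<^esub>k\<in>{..n}. pw (Suc n) +> (x k \<otimes> y (n - k)))"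
    unfolding gr_ring_def monoid.simps using c by (intro H.S.finsum_cong') auto
  also have "\<dots> = pw (Suc n) +> (\<Oplus>k\<in>{..n}. x k \<otimes> y (n - k))"
    using c by (subst H.hom_finsum) (auto simp: o_def)
  finally show "(gr_class x \<otimes>\<^bsub>G\<^esub> gr_class y) n = gr_class (\<lambda>n. \<Oplus>k\<in>{..n}. x k \<otimes> y (n - k)) n"
    by (simp add: gr_class_def)
qed

lemma homogeneous_seq_mult:
  assumes x: "homogeneous_seq x" and y: "homogeneous_seq y"
  shows "homogeneous_seq (\<lambda>n. \<Oplus>k\<in>{..n}. x k \<otimes> y (n - k))"
  unfolding homogeneous_seq_def
proof
  show "\<forall>n. (\<Oplus>k\<in>{..n}. x k \<otimes> y (n - k)) \<in> pw n"
  proof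
    fix n
    have "x k \<otimes> y (n - k) \<in> pw n" if "k \<le> n" for k
      using pw_mult[of "x k" k "y (n - k)" "n - k"] that x y by (simp add: homogeneous_seqD)
    then show "(\<Oplus>k\<in>{..n}. x k \<otimes> y (n - k)) \<in> pw n" by (intro pw_finsum) auto
  qed
  obtain M N where M: "\<And>n. n \<ge> M \<Longrightarrow> x n \<in> pw (Suc n)" and N: "\<And>n. n \<ge> N \<Longrightarrow> y n \<in> pw (Suc n)"
  proof -
    have "\<exists>M. \<forall>n\<ge>M. z n \<in> pw (Suc n)" if "homogeneous_seq z" for z
      using that unfolding homogeneous_seq_def finite_nat_set_iff_bounded
      by (metis (mono_tags, lifting) leD mem_Collect_eq)
    then show ?thesis using that x y by blast
  qed
  \<comment> \<open>For \<open>n \<ge> M + N\<close> every term has \<open>k \<ge> M\<close> or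
    \<open>n - k \<ge> N\<close>, so one of its factors lies one power higher than its
    degree.\<close>
  have "(\<Oplus>k\<in>{..n}. x k \<otimes> y (n - k)) \<in> pw (Suc n)" if "n \<ge> M + N" for n
  proof (rule pw_finsum)
    fix k assume "k \<in> {..n}"
    then have k: "k \<le> n" by simp
    show "x k \<otimes> y (n - k) \<in> pw (Suc n)"
    proof (cases "k \<ge> M")
      case True
      then show ?thesis
        using pw_mult[OF M[OF True] homogeneous_seqD(1)[OF y, of "n - k"]] k by simp
    next
      case False
      then have "n - k \<ge> N" using that by simp
      then show ?thesis
        using pw_mult[OF homogeneous_seqD(1)[OF x, of k] N[of "n - k"]] k by simp
    qed
  qed
  then have "{n. (\<Oplus>k\<in>{..n}. x k \<otimes> y (n - k)) \<notin> pw (Suc n)} \<subseteq> {..<M + N}"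
    by (auto simp: not_le[symmetric])
  then show "finite {n. (\<Oplus>k\<in>{..n}. x k \<otimes> y (n - k)) \<notin> pw (Suc n)}"
    by (rule finite_subset) simp
qed

text \<open>A graded right ideal of \<open>gr R\<close> is encoded by the preimages \<open>V n\<close> of its homogeneous
  components, which lie between \<open>I\<^sup>n\<^sup>+\<^sup>1\<close> and \<open>I\<^sup>n\<close>.\<close>

definition graded_right :: "(nat \<Rightarrow> 'a set) \<Rightarrow> bool" where
  "graded_right V \<longleftrightarrow> (\<forall>n. additive_subgroup (V n) R \<and> pw (Suc n) \<subseteq> V n \<and> V n \<subseteq> pw n) \<and>
     (\<forall>n k. \<forall>x\<in>V n. \<forall>r\<in>pw k. x \<otimes> r \<in> V (n + k))"

definition gr_part :: "(nat \<Rightarrow> 'a set) \<Rightarrow> (nat \<Rightarrow> 'a set) set" where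
  "gr_part V = {f \<in> carrier G. \<forall>n. f n \<subseteq> V n}"

text \<open>\<open>V n\<close> is additive and contains \<open>I^(n+1)\<close>, so it contains the
  whole coset of each of its elements.\<close>

lemma gr_class_in_gr_part:
  assumes V: "graded_right V" and x: "homogeneous_seq x"
  shows "gr_class x \<in> gr_part V \<longleftrightarrow> (\<forall>n. x n \<in> V n)"
proof -
  have "pw (Suc n) +> x n \<subseteq> V n \<longleftrightarrow> x n \<in> V n" for n
  proof
    assume "pw (Suc n) +> x n \<subseteq> V n"
    moreover have "x n \<in> pw (Suc n) +> x n"
      using abelian_subgroup.a_rcos_self[of "pw (Suc n)" R] x pw_ideal
      by (simp add: ideal.axioms(1) abelian_subgroupI3 is_abelian_group homogeneous_seqD)
    ultimately show "x n \<in> V n" by blast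
  next
    assume "x n \<in> V n"
    moreover have "additive_subgroup (V n) R" "pw (Suc n) \<subseteq> V n" using V by (auto simp: graded_right_def)
    ultimately show "pw (Suc n) +> x n \<subseteq> V n"
      by (auto simp: a_r_coset_def' additive_subgroup.a_closed)
  qed
  then show ?thesis
    using gr_class_carrier[OF x] by (simp add: gr_part_def gr_class_def)
qed

lemma additive_subgroup_finsum:
  assumes "additive_subgroup H R" "\<And>i. i \<in> A \<Longrightarrow> f i \<in> H"
  shows "finsum R f A \<in> H"
  using assms(2)
proof (induction A rule: infinite_finite_induct)
  case (insert x F)
  then have "f \<in> F \<rightarrow> carrier R" "f x \<in> carrier R"
    using additive_subgroup.a_subset[OF assms(1)] by auto
  then show ?case using insert additive_subgroup.a_closed[OF assms(1)] by simp
qed (auto simp: additive_subgroup.zero_closed[OF assms(1)])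

lemma right_ideal_gr_part:
  assumes V: "graded_right V"
  shows "right_ideal (gr_part V) G"
proof -
  interpret G: abelian_group G by (rule abelian_group_G)
  have sub: "additive_subgroup (V n) R" for n using V by (simp add: graded_right_def)
  have rep: "\<exists>x. homogeneous_seq x \<and> f = gr_class x \<and> (\<forall>n. x n \<in> V n)" if "f \<in> gr_part V" for f
  proof -
    have "f \<in> carrier G" using that by (simp add: gr_part_def)
    then obtain x where "homogeneous_seq x" "f = gr_class x" using carrier_G by blast
    then show ?thesis using that gr_class_in_gr_part[OF V] by blast
  qed
  have mem: "gr_class x \<in> gr_part V" if "homogeneous_seq x" "\<And>n. x n \<in> V n" for x
    using that gr_class_in_gr_part[OF V] by blast
  have "subgroup (gr_part V) (add_monoid G)"
  proof (rule G.add.subgroupI)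
    show "gr_part V \<subseteq> carrier G" by (auto simp: gr_part_def)
    have "gr_class (\<lambda>n. \<zero>) \<in> gr_part V"
      using mem homogeneous_seq_zero additive_subgroup.zero_closed[OF sub] by blast
    then show "gr_part V \<noteq> {}" by blast
  next
    fix f assume "f \<in> gr_part V"
    then obtain x where x: "homogeneous_seq x" "f = gr_class x" "\<And>n. x n \<in> V n" using rep by blast
    have "\<ominus>\<^bsub>G\<^esub> f = gr_class (\<lambda>n. \<ominus> x n)"
      unfolding x(2) by (rule G.minus_equality) (auto simp: gr_class_neg gr_class_carrier homogeneous_seq_neg x)
    then show "\<ominus>\<^bsub>G\<^esub> f \<in> gr_part V"
      using mem[OF homogeneous_seq_neg[OF x(1)]] additive_subgroup.a_inv_closed[OF sub]
        x(3) is_abelian_group by simp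
  next
    fix f g assume "f \<in> gr_part V" "g \<in> gr_part V"
    then obtain x y where "homogeneous_seq x" "f = gr_class x" "\<And>n. x n \<in> V n"
        "homogeneous_seq y" "g = gr_class y" "\<And>n. y n \<in> V n" using rep by metis
    then show "f \<oplus>\<^bsub>G\<^esub> g \<in> gr_part V"
      using mem[OF homogeneous_seq_add] additive_subgroup.a_closed[OF sub] by (simp add: gr_class_add)
  qed
  moreover have "f \<otimes>\<^bsub>G\<^esub> g \<in> gr_part V" if g: "g \<in> carrier G" and f: "f \<in> gr_part V" for f g
  proof -
    obtain x where x: "homogeneous_seq x" "f = gr_class x" "\<And>n. x n \<in> V n"
      using rep[OF f] by blast
    obtain y where y: "homogeneous_seq y" "g = gr_class y" using g carrier_G by blast
    have "(\<Oplus>k\<in>{..n}. x k \<otimes> y (n - k)) \<in> V n" for n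
    proof (rule additive_subgroup_finsum[OF sub])
      fix k assume "k \<in> {..n}"
      moreover have "x k \<otimes> y (n - k) \<in> V (k + (n - k))"
        using V x(3) homogeneous_seqD(1)[OF y(1)] unfolding graded_right_def by blast
      ultimately show "x k \<otimes> y (n - k) \<in> V n" by simp
    qed
    then show ?thesis
      using mem[OF homogeneous_seq_mult[OF x(1) y(1)]] by (simp add: x(2) y(2) gr_class_mult x(1) y(1))
  qed
  ultimately show ?thesis
    by (simp add: right_ideal_def additive_subgroup_def)
qed

text \<open>\<open>W m\<close> can be recovered from \<open>gr_part (W m)\<close> by elements
  concentrated in one degree. Stabilisation in \<open>gr R\<close> therefore yields one
  \<open>N\<close> that serves all degrees at once.\<close>

lemma graded_right_acc:
  assumes noeth: "right_noetherian G"
    and W: "\<And>m. graded_right (W m)" and mono: "\<And>m n. W m n \<subseteq> W (Suc m) n"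
  shows "\<exists>N. \<forall>m\<ge>N. W m = W N"
proof -
  have "gr_part (W m) \<subseteq> gr_part (W (Suc m))" for m
    unfolding gr_part_def using mono by blast
  then obtain N where N: "\<And>m. m \<ge> N \<Longrightarrow> gr_part (W m) = gr_part (W N)"
    using noeth[unfolded right_noetherian_def, rule_format, of "\<lambda>m. gr_part (W m)"]
      right_ideal_gr_part[OF W] by blast
  have incl: "W m n \<subseteq> W m' n" if "gr_part (W m) = gr_part (W m')" for m m' n
  proof
    fix x assume x: "x \<in> W m n"
    let ?s = "\<lambda>k. if k = n then x else \<zero>"
    have "x \<in> pw n" using W x by (auto simp: graded_right_def)
    moreover have "{k. ?s k \<notin> pw (Suc k)} \<subseteq> {n}" by auto
    ultimately have s: "homogeneous_seq ?s"
      using finite_subset by (auto simp: homogeneous_seq_def)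
    have "\<forall>k. ?s k \<in> W m k"
      using x W[of m] additive_subgroup.zero_closed by (auto simp: graded_right_def)
    then have "gr_class ?s \<in> gr_part (W m')"
      using gr_class_in_gr_part[OF W s] that by blast
    then show "x \<in> W m' n"
      using gr_class_in_gr_part[OF W s] by (metis (full_types))
  qed
  have "W m = W N" if "m \<ge> N" for m
    using incl[of m N] incl[of N m] N[OF that] by (intro ext) auto
  then show ?thesis by blast
qed

text \<open>The coefficients allowed in front of a generator of degree \<open>d\<close> in degree \<open>n\<close>. For \<open>n < d\<close> truncated
  subtraction would give \<open>I\<^sup>0 = R\<close>, whereas only \<open>0\<close> is wanted.\<close>

definition coeff_space :: "nat \<Rightarrow> nat \<Rightarrow> 'a set" where
  "coeff_space n d = (if d \<le> n then pw (n - d) else {\<zero>})"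

lemma coeff_space_subset: "coeff_space n d \<subseteq> pw (n - d)"
  by (simp add: coeff_space_def)

lemma coeff_space_carrier: "x \<in> coeff_space n d \<Longrightarrow> x \<in> carrier R"
  using coeff_space_subset pw_carrier by blast

lemma coeff_space_zero: "\<zero> \<in> coeff_space n d"
  by (simp add: coeff_space_def)

lemma coeff_space_add: "x \<in> coeff_space n d \<Longrightarrow> y \<in> coeff_space n d \<Longrightarrow> x \<oplus> y \<in> coeff_space n d"
  by (auto simp: coeff_space_def pw_add)

lemma coeff_space_mult: "x \<in> coeff_space n d \<Longrightarrow> r \<in> pw k \<Longrightarrow> x \<otimes> r \<in> coeff_space (n + k) d"
  using pw_mult[of x "n - d" r k] pw_carrier[of r k]
  by (auto simp: coeff_space_def split: if_splits)

section \<open>Graded right ideals spanned by finitely many elements\<close>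

abbreviation comb :: "('a \<times> nat) set \<Rightarrow> ('a \<times> nat \<Rightarrow> 'a) \<Rightarrow> 'a" where
  "comb F c \<equiv> (\<Oplus>p\<in>F. fst p \<otimes> c p)"

text \<open>If \<open>x \<in> I^d\<close> for all \<open>(x, d) \<in> F\<close>, this is the
  preimage in \<open>I^n\<close> of degree \<open>n\<close> of the right ideal of
  \<open>gr R\<close> generated by the classes of \<open>x\<close> in degree \<open>d\<close>. The
  degree is stored because \<open>x\<close> may lie in a higher power than \<open>I^d\<close>, in
  which case its class vanishes.\<close>

definition gr_span :: "('a \<times> nat) set \<Rightarrow> nat \<Rightarrow> 'a set" where
  "gr_span F n = {comb F c \<oplus> v | c v. (\<forall>p\<in>F. c p \<in> coeff_space n (snd p)) \<and> v \<in> pw (Suc n)}"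

lemma gr_spanI:
  "(\<And>p. p \<in> F \<Longrightarrow> c p \<in> coeff_space n (snd p)) \<Longrightarrow> v \<in> pw (Suc n) \<Longrightarrow> comb F c \<oplus> v \<in> gr_span F n"
  unfolding gr_span_def by blast

lemma gr_spanE:
  assumes "x \<in> gr_span F n"
  obtains c v where "x = comb F c \<oplus> v" "\<And>p. p \<in> F \<Longrightarrow> c p \<in> coeff_space n (snd p)" "v \<in> pw (Suc n)"
  using assms unfolding gr_span_def by blast

lemma graded_right_gr_span:
  assumes F: "finite F" "\<And>p. p \<in> F \<Longrightarrow> fst p \<in> pw (snd p)"
  shows "graded_right (gr_span F)"
proof -
  have Fc: "fst p \<in> carrier R" if "p \<in> F" for p using F(2)[OF that] pw_carrier by blast
  have pw: "comb F c \<in> pw n" if "\<And>p. p \<in> F \<Longrightarrow> c p \<in> coeff_space n (snd p)" for c n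
  proof (rule pw_finsum)
    fix p assume p: "p \<in> F"
    then have "fst p \<otimes> c p \<in> pw (snd p + (n - snd p))"
      using F(2) subsetD[OF coeff_space_subset that] by (intro pw_mult)
    then show "fst p \<otimes> c p \<in> pw n" by (rule pw_antiD) simp
  qed
  have span_pw: "gr_span F n \<subseteq> pw n" for n
  proof
    fix x assume "x \<in> gr_span F n"
    then obtain c v where "x = comb F c \<oplus> v" "\<And>p. p \<in> F \<Longrightarrow> c p \<in> coeff_space n (snd p)" "v \<in> pw (Suc n)"
      by (rule gr_spanE) blast
    then show "x \<in> pw n" using pw[of c n] pw_Suc_subset by (blast intro: pw_add)
  qed
  have pw_span: "pw (Suc n) \<subseteq> gr_span F n" for n
  proof
    fix v assume v: "v \<in> pw (Suc n)"
    have "comb F (\<lambda>p. \<zero>) = (\<Oplus>p\<in>F. \<zero>)"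
      using Fc by (intro finsum_cong') auto
    then have "comb F (\<lambda>p. \<zero>) \<oplus> v = v" using pw_carrier[OF v] by simp
    then show "v \<in> gr_span F n"
      using gr_spanI[of F "\<lambda>p. \<zero>" n v] v by (simp add: coeff_space_zero)
  qed
  have mult: "x \<otimes> r \<in> gr_span F (n + k)" if x: "x \<in> gr_span F n" and r: "r \<in> pw k" for x r n k
  proof -
    from x obtain c v where x: "x = comb F c \<oplus> v"
      and c: "\<And>p. p \<in> F \<Longrightarrow> c p \<in> coeff_space n (snd p)" and v: "v \<in> pw (Suc n)"
      by (rule gr_spanE) blast
    have cc: "c p \<in> carrier R" if "p \<in> F" for p using c[OF that] coeff_space_carrier by blast
    have rc: "r \<in> carrier R" using r pw_carrier by blast
    have "x \<otimes> r = comb F c \<otimes> r \<oplus> v \<otimes> r"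
      unfolding x using rc v Fc cc pw_carrier by (intro l_distr) auto
    also have "comb F c \<otimes> r = (\<Oplus>p\<in>F. fst p \<otimes> c p \<otimes> r)"
      using F(1) rc Fc cc by (intro finsum_ldistr) auto
    also have "\<dots> = comb F (\<lambda>p. c p \<otimes> r)"
      using rc Fc cc by (intro finsum_cong') (auto simp: m_assoc)
    finally have eq: "x \<otimes> r = comb F (\<lambda>p. c p \<otimes> r) \<oplus> v \<otimes> r" .
    show ?thesis
      unfolding eq using c r pw_mult[OF v r] by (intro gr_spanI coeff_space_mult) auto
  qed
  have add: "x \<oplus> y \<in> gr_span F n" if "x \<in> gr_span F n" "y \<in> gr_span F n" for x y n
  proof -
    from that(1) obtain c v where x: "x = comb F c \<oplus> v"
      and c: "\<And>p. p \<in> F \<Longrightarrow> c p \<in> coeff_space n (snd p)" and v: "v \<in> pw (Suc n)"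
      by (rule gr_spanE) blast
    from that(2) obtain d w where y: "y = comb F d \<oplus> w"
      and d: "\<And>p. p \<in> F \<Longrightarrow> d p \<in> coeff_space n (snd p)" and w: "w \<in> pw (Suc n)"
      by (rule gr_spanE) blast
    have cc: "c p \<in> carrier R" "d p \<in> carrier R" if "p \<in> F" for p
      using c[OF that] d[OF that] coeff_space_carrier by blast+
    have "comb F (\<lambda>p. c p \<oplus> d p) = (\<Oplus>p\<in>F. fst p \<otimes> c p \<oplus> fst p \<otimes> d p)"
      using Fc cc by (intro finsum_cong') (auto simp: r_distr)
    also have "\<dots> = comb F c \<oplus> comb F d"
      using Fc cc by (intro finsum_addf) auto
    finally have "x \<oplus> y = comb F (\<lambda>p. c p \<oplus> d p) \<oplus> (v \<oplus> w)"
      using x y v w pw_carrier pw[OF c] pw[OF d] by (simp add: a_ac)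
    then show ?thesis
      using gr_spanI[of F "\<lambda>p. c p \<oplus> d p" n "v \<oplus> w"] c d v w by (simp add: coeff_space_add pw_add)
  qed
  have "additive_subgroup (gr_span F n) R" for n
  proof (intro additive_subgroupI add.subgroupI)
    show "gr_span F n \<subseteq> carrier R" using span_pw pw_carrier by blast
    show "gr_span F n \<noteq> {}" using pw_span pw_zero by blast
  next
    fix x assume x: "x \<in> gr_span F n"
    \<comment> \<open>Negation is right multiplication by an element of \<open>I^0\<close>.\<close>
    then have "x \<otimes> \<ominus> \<one> \<in> gr_span F n" using mult[OF x, of "\<ominus> \<one>" 0] by (simp add: pw_0)
    moreover have "x \<in> carrier R" using x span_pw pw_carrier by blast
    ultimately show "\<ominus> x \<in> gr_span F n" by (simp add: r_minus)
  qed (rule add)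
  then show ?thesis
    using span_pw pw_span mult by (simp add: graded_right_def)
qed

lemma gr_span_insert_mono:
  assumes F: "finite F" "\<And>q. q \<in> insert p F \<Longrightarrow> fst q \<in> carrier R"
  shows "gr_span F n \<subseteq> gr_span (insert p F) n"
proof (cases "p \<in> F")
  case False
  show ?thesis
  proof
    fix x assume "x \<in> gr_span F n"
    then obtain c v where x: "x = comb F c \<oplus> v"
      and c: "\<And>p. p \<in> F \<Longrightarrow> c p \<in> coeff_space n (snd p)" and v: "v \<in> pw (Suc n)"
      by (rule gr_spanE) blast
    let ?c = "c(p := \<zero>)"
    have cc: "c q \<in> carrier R" if "q \<in> F" for q using c[OF that] coeff_space_carrier by blast
    have "comb F ?c = comb F c"
      using F cc False by (intro finsum_cong') auto
    moreover have "comb (insert p F) ?c = fst p \<otimes> ?c p \<oplus> comb F ?c"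
      using F cc False by (intro finsum_insert) auto
    moreover have "comb F c \<in> carrier R" using F cc by (intro finsum_closed) auto
    ultimately have "comb (insert p F) ?c = comb F c" using F by simp
    moreover have "comb (insert p F) ?c \<oplus> v \<in> gr_span (insert p F) n"
      using c v by (intro gr_spanI) (auto simp: coeff_space_zero)
    ultimately show "x \<in> gr_span (insert p F) n" using x by simp
  qed
qed (simp add: insert_absorb)

lemma gr_span_insert_mem:
  assumes F: "finite F" "\<And>q. q \<in> F \<Longrightarrow> fst q \<in> carrier R" and x: "x \<in> carrier R"
  shows "x \<in> gr_span (insert (x, d) F) d"
proof -
  let ?F = "insert (x, d) F"
  \<comment> \<open>The coefficient \<open>\<one>\<close> is admissible because
    \<open>coeff_space d d\<close> is all of \<open>R\<close>.\<close>
  let ?c = "\<lambda>p. if (x, d) = p then \<one> else \<zero>"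
  have "comb ?F ?c = (\<Oplus>p\<in>?F. if (x, d) = p then x else \<zero>)"
    using F x by (intro finsum_cong') auto
  also have "\<dots> = x"
    using F x by (intro finsum_singleton) auto
  finally have "comb ?F ?c \<oplus> \<zero> = x" using x by simp
  moreover have "comb ?F ?c \<oplus> \<zero> \<in> gr_span ?F d"
    by (intro gr_spanI) (auto simp: coeff_space_def pw_0)
  ultimately show ?thesis by simp
qed

text \<open>Otherwise every finite \<open>F\<close> misses some
  \<open>x \<in> K \<inter> I^d\<close> in degree \<open>d\<close>. Adjoining the missing elements
  one after another gives graded right ideals that grow at every step, against the chain condition.
  In effect the right ideal of \<open>gr R\<close> attached to \<open>K\<close> is finitely
  generated.\<close>

lemma gr_span_generators:
  assumes noeth: "right_noetherian G" and K: "right_ideal K R"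
  shows "\<exists>F. finite F \<and> (\<forall>p\<in>F. fst p \<in> K \<inter> pw (snd p)) \<and> (\<forall>d. K \<inter> pw d \<subseteq> gr_span F d)"
proof (rule ccontr)
  let ?ok = "\<lambda>F. finite F \<and> (\<forall>p\<in>F. fst p \<in> K \<inter> pw (snd p))"
  assume "\<not> ?thesis"
  then have "\<forall>F. \<exists>p. ?ok F \<longrightarrow> fst p \<in> K \<inter> pw (snd p) \<and> fst p \<notin> gr_span F (snd p)"
    by (metis fst_conv snd_conv subsetI)
  then obtain g where g: "\<And>F. ?ok F \<Longrightarrow> fst (g F) \<in> K \<inter> pw (snd (g F)) \<and> fst (g F) \<notin> gr_span F (snd (g F))"
    by metis
  define Fs where "Fs = rec_nat {} (\<lambda>_ F. insert (g F) F)"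
  have Fs0: "Fs 0 = {}" and FsS: "\<And>m. Fs (Suc m) = insert (g (Fs m)) (Fs m)" by (auto simp: Fs_def)
  have ok: "?ok (Fs m)" for m
  proof (induction m)
    case 0
    then show ?case by (simp add: Fs0)
  next
    case (Suc m)
    then show ?case using g[OF Suc] by (simp add: FsS)
  qed
  have okc: "fst p \<in> carrier R" if "p \<in> Fs m" for p m using that ok[of m] pw_carrier by blast
  have "\<exists>N. \<forall>m\<ge>N. gr_span (Fs m) = gr_span (Fs N)"
  proof (rule graded_right_acc[OF noeth])
    show "graded_right (gr_span (Fs m))" for m
      using ok[of m] by (intro graded_right_gr_span) auto
    show "gr_span (Fs m) n \<subseteq> gr_span (Fs (Suc m)) n" for m n
      using ok[of m] okc[of _ "Suc m"] unfolding FsS by (intro gr_span_insert_mono) auto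
  qed
  then obtain N where N: "gr_span (Fs (Suc N)) = gr_span (Fs N)" by (meson le_SucI order_refl)
  obtain x d where p: "g (Fs N) = (x, d)" by fastforce
  have "x \<in> gr_span (Fs (Suc N)) d"
    unfolding FsS p using ok[of N] okc[of _ N] okc[of "(x, d)" "Suc N"] p
    by (intro gr_span_insert_mem) (auto simp: FsS)
  then show False using g[OF ok[of N]] p N by simp
qed

section \<open>Right ideals of \<open>R\<close> and their adic closures\<close>

lemma minus_cancel:
  assumes "a \<in> carrier R" "b \<in> carrier R" "c \<in> carrier R"
  shows "(a \<ominus> c) \<ominus> (b \<ominus> c) = a \<ominus> b" "a \<ominus> (b \<oplus> c) \<oplus> c = a \<ominus> b"
    "a \<ominus> (a \<ominus> b) = b" "a \<oplus> b \<oplus> (c \<ominus> a) = b \<oplus> c"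
  using assms by algebra+

text \<open>Approximating elements of the closure by generators taken from \<open>K\<close> proves
  two facts at once: \<open>K\<close> is finitely generated, and the closure is no larger than
  \<open>K\<close>.\<close>

definition adic_closure :: "'a set \<Rightarrow> 'a set" where
  "adic_closure K = {x \<in> carrier R. \<forall>n. \<exists>k\<in>K. x \<ominus> k \<in> pw n}"

text \<open>Successive approximation along the filtration: at stage \<open>d\<close> the remainder in \<open>I\<^sup>d\<close> is corrected
  by a combination of the generators with coefficients tending to zero.\<close>

theorem adic_closure_fin_gen:
  assumes noeth: "right_noetherian G" and K: "right_ideal K R"
  shows "\<exists>F :: ('a \<times> nat) set. finite F \<and> fst ` F \<subseteq> K \<and>
    (\<forall>x\<in>adic_closure K. \<exists>c. (\<forall>p\<in>F. c p \<in> carrier R) \<and> x = comb F c)"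
proof -
  have Ksub: "additive_subgroup K R" and Kr: "\<And>x r. x \<in> K \<Longrightarrow> r \<in> carrier R \<Longrightarrow> x \<otimes> r \<in> K"
    using K by (auto simp: right_ideal_def)
  have Kc: "x \<in> carrier R" if "x \<in> K" for x using additive_subgroup.a_subset[OF Ksub] that by blast
  have Kadd: "x \<oplus> y \<in> K" if "x \<in> K" "y \<in> K" for x y using additive_subgroup.a_closed[OF Ksub] that .
  have Kneg: "\<ominus> x \<in> K" if "x \<in> K" for x
    using additive_subgroup.a_inv_closed[OF Ksub] is_abelian_group that by blast
  obtain F where F: "finite F" "\<And>p. p \<in> F \<Longrightarrow> fst p \<in> K \<inter> pw (snd p)"
    and span: "\<And>d. K \<inter> pw d \<subseteq> gr_span F d"
    using gr_span_generators[OF assms] by metis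
  have Fc: "fst p \<in> carrier R" if "p \<in> F" for p using F(2)[OF that] pw_carrier by blast
  let ?C = "adic_closure K"
  have step: "\<exists>c. (\<forall>p\<in>F. c p \<in> coeff_space d (snd p)) \<and> x \<ominus> comb F c \<in> ?C \<inter> pw (Suc d)"
    if x: "x \<in> ?C \<inter> pw d" for x d
  proof -
    have xc: "x \<in> carrier R" using x by (simp add: adic_closure_def)
    \<comment> \<open>A point of the closure is replaced by some \<open>k \<in> K\<close> that
      agrees with it modulo \<open>I^(d+1)\<close>. Then \<open>k\<close> also lies in
      \<open>I^d\<close>, and the generators expand it up to an error in
      \<open>I^(d+1)\<close>.\<close>
    obtain k where k: "k \<in> K" "x \<ominus> k \<in> pw (Suc d)" using x by (auto simp: adic_closure_def)
    have "k = x \<ominus> (x \<ominus> k)" using xc Kc[OF k(1)] by (simp add: minus_cancel)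
    then have "k \<in> pw d" using x k(2) pw_Suc_subset pw_minus by (metis IntD2 subsetD)
    then obtain c v where kc: "k = comb F c \<oplus> v"
      and c: "\<And>p. p \<in> F \<Longrightarrow> c p \<in> coeff_space d (snd p)" and v: "v \<in> pw (Suc d)"
      using span k(1) by (blast elim: gr_spanE)
    have cc: "c p \<in> carrier R" if "p \<in> F" for p using c[OF that] coeff_space_carrier by blast
    have s: "comb F c \<in> K"
      using F(2) Kr cc by (intro additive_subgroup_finsum[OF Ksub]) auto
    have carr: "comb F c \<in> carrier R" "v \<in> carrier R" "k \<in> carrier R"
      using Kc s v pw_carrier k by auto
    have "x \<ominus> comb F c = (x \<ominus> k) \<oplus> v"
    proof -
      have "x \<ominus> k \<oplus> v = x \<ominus> (comb F c \<oplus> v) \<oplus> v" by (simp add: kc)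
      also have "\<dots> = x \<ominus> comb F c" using carr xc by (simp add: minus_cancel)
      finally show ?thesis by simp
    qed
    then have "x \<ominus> comb F c \<in> pw (Suc d)" using k v by (simp add: pw_add)
    moreover have "x \<ominus> comb F c \<in> ?C"
      unfolding adic_closure_def
    proof (intro CollectI conjI allI)
      fix n
      obtain l where l: "l \<in> K" "x \<ominus> l \<in> pw n" using x by (auto simp: adic_closure_def)
      have "(x \<ominus> comb F c) \<ominus> (l \<ominus> comb F c) = x \<ominus> l"
        using xc carr Kc[OF l(1)] by (simp add: minus_cancel)
      then show "\<exists>l\<in>K. (x \<ominus> comb F c) \<ominus> l \<in> pw n"
        using l s Kadd Kneg by (metis a_minus_def)
    qed (use xc carr in simp)
    ultimately show ?thesis using c by blast
  qed
  then obtain ch where ch: "\<And>x d. x \<in> ?C \<inter> pw d \<Longrightarrow>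
      (\<forall>p\<in>F. ch x d p \<in> coeff_space d (snd p)) \<and> x \<ominus> comb F (ch x d) \<in> ?C \<inter> pw (Suc d)"
    by metis
  have "\<exists>c. (\<forall>p\<in>F. c p \<in> carrier R) \<and> x = comb F c" if x: "x \<in> ?C" for x
  proof -
    \<comment> \<open>\<open>xs d\<close> is the remainder in \<open>I^d\<close> after
      \<open>d\<close> corrections; \<open>c d\<close> holds the coefficients of the next
      one.\<close>
    define xs where "xs = rec_nat x (\<lambda>d y. y \<ominus> comb F (ch y d))"
    define c where "c d = ch (xs d) d" for d
    have xs0: "xs 0 = x" and xsS: "\<And>d. xs (Suc d) = xs d \<ominus> comb F (c d)" by (auto simp: xs_def c_def)
    have xs: "xs d \<in> ?C \<inter> pw d" for d
    proof (induction d)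
      case 0
      then show ?case using x by (simp add: xs0 pw_0 adic_closure_def)
    next
      case (Suc d)
      then show ?case using ch[OF Suc] by (simp add: xsS c_def)
    qed
    have c: "c d p \<in> coeff_space d (snd p)" if "p \<in> F" for d p
      using ch[OF xs[of d]] that by (simp add: c_def)
    have cc: "c d p \<in> carrier R" if "p \<in> F" for d p using c[OF that] coeff_space_carrier by blast
    have comb_c: "comb F (c d) \<in> carrier R" for d
      using Fc cc by (intro finsum_closed) auto
    have xsc: "xs d \<in> carrier R" for d using xs pw_carrier by blast
    have partial: "x = (\<Oplus>d\<in>{..<q}. comb F (c d)) \<oplus> xs q" for q
    proof (induction q)
      case 0
      then show ?case using xsc[of 0] by (simp add: xs0)
    next
      case (Suc q)
      let ?a = "\<Oplus>d\<in>{..<q}. comb F (c d)"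
      have "(\<Oplus>d\<in>{..<Suc q}. comb F (c d)) = comb F (c q) \<oplus> ?a"
        using comb_c by (simp add: lessThan_Suc Pi_def)
      moreover have "?a \<in> carrier R" using comb_c by (simp add: Pi_def)
      then have "comb F (c q) \<oplus> ?a \<oplus> (xs q \<ominus> comb F (c q)) = ?a \<oplus> xs q"
        using comb_c[of q] xsc[of q] by (simp add: minus_cancel)
      ultimately show ?case using Suc by (simp add: xsS)
    qed
    have "adic_sums (\<lambda>d. comb F (c d)) x"
      unfolding adic_sums_def
    proof (intro conjI allI)
      fix m
      have "adic_cong m (\<Oplus>d\<in>{..<q}. comb F (c d)) x" if "q \<ge> m" for q
      proof -
        have "adic_cong m ((\<Oplus>d\<in>{..<q}. comb F (c d)) \<oplus> \<zero>) ((\<Oplus>d\<in>{..<q}. comb F (c d)) \<oplus> xs q)"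
          using comb_c xs[of q] that
          by (intro adic_cong_add adic_cong_refl adic_cong_sym[of m "xs q" \<zero>])
            (auto simp: adic_cong_zero intro: pw_antiD)
        then show ?thesis using partial[of q] comb_c by (simp add: Pi_def)
      qed
      then show "\<exists>p. \<forall>q\<ge>p. adic_cong m (\<Oplus>d\<in>{..<q}. comb F (c d)) x" by blast
    qed (use comb_c x in \<open>auto simp: adic_closure_def\<close>)
    \<comment> \<open>For a fixed generator \<open>p\<close> the coefficient of stage
      \<open>d\<close> lies in \<open>I^(d - snd p)\<close>. These coefficients sum to some
      \<open>r p\<close>, and the finite sum over \<open>F\<close> commutes with the limit.\<close>
    moreover have "\<exists>r. adic_sums (\<lambda>d. c d p) r" if p: "p \<in> F" for p
    proof (rule adic_sums_exists)
      fix m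
      have "c d p \<in> pw m" if "d \<ge> m + snd p" for d
        using c[OF p, of d] coeff_space_subset[of d "snd p"] pw_antiD[of "c d p" "d - snd p" m] that
        by auto
      then show "\<exists>q. \<forall>d\<ge>q. c d p \<in> pw m" by blast
    qed (use cc p in auto)
    then obtain r where r: "\<And>p. p \<in> F \<Longrightarrow> adic_sums (\<lambda>d. c d p) (r p)" by metis
    have "adic_sums (\<lambda>d. comb F (c d)) (comb F r)"
      using r Fc by (intro adic_sums_finsum adic_sums_l)
    ultimately have "x = comb F r" using adic_sums_unique by blast
    then show ?thesis using r adic_sums_carrier by blast
  qed
  then show ?thesis using F by (intro exI[of _ F]) auto
qed

lemma subset_adic_closure: "K \<subseteq> carrier R \<Longrightarrow> K \<subseteq> adic_closure K"
proof
  fix x assume "K \<subseteq> carrier R" "x \<in> K"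
  then show "x \<in> adic_closure K"
    unfolding adic_closure_def by (auto intro!: bexI[of _ x] simp: a_minus_def r_neg)
qed

text \<open>The limit lies in the closure, hence is a right combination of generators, and these
  were chosen in \<open>K\<close> itself.\<close>

lemma right_ideal_closed:
  assumes noeth: "right_noetherian G" and K: "right_ideal K R"
    and s: "adic_sums s l" "\<And>i. s i \<in> K"
  shows "l \<in> K"
proof -
  have Ksub: "additive_subgroup K R" and Kr: "\<And>x r. x \<in> K \<Longrightarrow> r \<in> carrier R \<Longrightarrow> x \<otimes> r \<in> K"
    using K by (auto simp: right_ideal_def)
  obtain F :: "('a \<times> nat) set" where F: "fst ` F \<subseteq> K"
    and gen: "\<And>x. x \<in> adic_closure K \<Longrightarrow> \<exists>c. (\<forall>p\<in>F. c p \<in> carrier R) \<and> x = comb F c"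
    using adic_closure_fin_gen[OF noeth K] by metis
  have "\<exists>k\<in>K. l \<ominus> k \<in> pw n" for n
  proof -
    obtain p where "adic_cong n (\<Oplus>i\<in>{..<p}. s i) l" using adic_sums_ev[OF s(1)] by blast
    moreover have "(\<Oplus>i\<in>{..<p}. s i) \<in> K" using s(2) by (intro additive_subgroup_finsum[OF Ksub])
    ultimately show ?thesis using adic_cong_sym unfolding adic_cong_def by blast
  qed
  then have "l \<in> adic_closure K" using adic_sums_carrier[OF s(1)] by (simp add: adic_closure_def)
  then obtain c where "\<And>p. p \<in> F \<Longrightarrow> c p \<in> carrier R" "l = comb F c" using gen by metis
  then show ?thesis using F Kr by (auto intro!: additive_subgroup_finsum[OF Ksub])
qed

text \<open>The union of the chain is again a right ideal, generated by finitely many of its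
  elements, and these all lie in one member.\<close>

lemma right_ideal_acc:
  assumes noeth: "right_noetherian G" and K: "\<And>n. right_ideal (K n) R" and mono: "\<And>n. K n \<subseteq> K (Suc n)"
  shows "\<exists>N. \<forall>n. K n \<subseteq> K N"
proof -
  have chain: "m \<le> n \<Longrightarrow> K m \<subseteq> K n" for m n
    by (rule lift_Suc_mono_le[of K]) (use mono in auto)
  have Ksub: "additive_subgroup (K n) R" and Kr: "\<And>x r. x \<in> K n \<Longrightarrow> r \<in> carrier R \<Longrightarrow> x \<otimes> r \<in> K n" for n
    using K by (auto simp: right_ideal_def)
  have Kc: "K n \<subseteq> carrier R" for n using additive_subgroup.a_subset[OF Ksub] .
  let ?U = "\<Union>n. K n"
  have U: "right_ideal ?U R"
    unfolding right_ideal_def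
  proof (intro conjI ballI)
    show "additive_subgroup ?U R"
    proof (intro additive_subgroupI add.subgroupI)
      show "?U \<subseteq> carrier R" using Kc by blast
      show "?U \<noteq> {}" using additive_subgroup.zero_closed[OF Ksub] by blast
    next
      fix x assume "x \<in> ?U"
      then show "\<ominus> x \<in> ?U" using additive_subgroup.a_inv_closed[OF Ksub] is_abelian_group by blast
    next
      fix x y assume "x \<in> ?U" "y \<in> ?U"
      then obtain m n where "x \<in> K m" "y \<in> K n" by blast
      then have "x \<in> K (max m n)" "y \<in> K (max m n)"
        using chain[of m "max m n"] chain[of n "max m n"] by auto
      then show "x \<oplus> y \<in> ?U" using additive_subgroup.a_closed[OF Ksub] by blast
    qed
  qed (use Kr in blast)
  obtain F :: "('a \<times> nat) set" where F: "finite F" "fst ` F \<subseteq> ?U"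
    and gen: "\<And>x. x \<in> adic_closure ?U \<Longrightarrow> \<exists>c. (\<forall>p\<in>F. c p \<in> carrier R) \<and> x = comb F c"
    using adic_closure_fin_gen[OF noeth U] by metis
  from F have "\<exists>N. fst ` F \<subseteq> K N"
  proof (induction F rule: finite_induct)
    case (insert p F)
    then obtain M N where "fst ` F \<subseteq> K M" "fst p \<in> K N" by auto
    then have "fst ` insert p F \<subseteq> K (max M N)"
      using chain[of M "max M N"] chain[of N "max M N"] by auto
    then show ?case by blast
  qed simp
  then obtain N where N: "fst ` F \<subseteq> K N" by blast
  have "x \<in> K N" if "x \<in> ?U" for x
  proof -
    have "x \<in> adic_closure ?U" using that subset_adic_closure[of ?U] Kc by blast
    then obtain c where "\<And>p. p \<in> F \<Longrightarrow> c p \<in> carrier R" "x = comb F c" using gen by metis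
    then show ?thesis using N Kr by (auto intro!: additive_subgroup_finsum[OF Ksub])
  qed
  then show ?thesis by blast
qed

end

section \<open>Prime ideals and quotients\<close>

text \<open>Additivity of \<open>f\<close> is the common ground of the automorphism and the skew
  derivation, so one locale serves both.\<close>

locale quot_endo = ideal P A for P and A (structure) +
  fixes f
  assumes f_closed: "x \<in> carrier A \<Longrightarrow> f x \<in> carrier A"
    and f_add: "x \<in> carrier A \<Longrightarrow> y \<in> carrier A \<Longrightarrow> f (x \<oplus> y) = f x \<oplus> f y"
    and f_P: "f ` P \<subseteq> P"
begin

section \<open>Cosets and preimages of ideals\<close>

lemma coset_eq: "x \<in> carrier A \<Longrightarrow> y \<in> carrier A \<Longrightarrow> P +> x = P +> y \<longleftrightarrow> x \<ominus> y \<in> P"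
  by (metis a_rcos_module_minus a_rcos_self a_repr_independence' ring_axioms)

lemma induced_map_coset: "x \<in> carrier A \<Longrightarrow> induced_map A P f (P +> x) = P +> f x"
proof -
  assume x: "x \<in> carrier A"
  have "P +> f z = P +> f x" if "z \<in> P +> x" for z
  proof -
    from that obtain p where p: "p \<in> P" "z = p \<oplus> x" by (auto simp: a_r_coset_def')
    then have c: "f z = f p \<oplus> f x" "f p \<in> P" using x f_add f_P by auto
    then have "f z \<in> P +> f x" by (auto simp: a_r_coset_def')
    then show ?thesis using a_repr_independence' f_closed x by metis
  qed
  moreover have "x \<in> P +> x" using x by (rule a_rcos_self)
  ultimately show ?thesis unfolding induced_map_def by blast
qed

definition quot_vimage :: "'a set set \<Rightarrow> 'a set" where
  "quot_vimage J = {x \<in> carrier A. P +> x \<in> J}"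

lemma carrier_quot: "carrier (A Quot P) = (+>) P ` carrier A"
  by (auto simp: FactRing_def A_RCOSETS_def')

lemma zero_quot: "\<zero>\<^bsub>A Quot P\<^esub> = P"
  by (simp add: FactRing_def)

lemma mult_quot:
  "x \<in> carrier A \<Longrightarrow> y \<in> carrier A \<Longrightarrow> (P +> x) \<otimes>\<^bsub>A Quot P\<^esub> (P +> y) = P +> (x \<otimes> y)"
  by (simp add: FactRing_def rcoset_mult_add)

lemma coset_P: "x \<in> carrier A \<Longrightarrow> P +> x = P \<longleftrightarrow> x \<in> P"
  using rcos_const_imp_mem a_rcos_const by blast

lemma quot_vimage_ideal: "ideal J (A Quot P) \<Longrightarrow> ideal (quot_vimage J) A"
  unfolding quot_vimage_def by (rule ring_hom_ring.ideal_vimage[OF rcos_ring_hom_ring])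

lemma zero_in_quot_ideal: "ideal J (A Quot P) \<Longrightarrow> P \<in> J"
  using additive_subgroup.zero_closed[OF ideal.axioms(1)] zero_quot by metis

lemma quot_vimage_superset: "ideal J (A Quot P) \<Longrightarrow> P \<subseteq> quot_vimage J"
  using zero_in_quot_ideal unfolding quot_vimage_def by (auto simp: a_rcos_const)

lemma quot_vimage_stable: "induced_map A P f ` J \<subseteq> J \<Longrightarrow> f ` quot_vimage J \<subseteq> quot_vimage J"
proof
  fix y assume J: "induced_map A P f ` J \<subseteq> J" and "y \<in> f ` quot_vimage J"
  then obtain x where x: "x \<in> carrier A" "P +> x \<in> J" "y = f x" by (auto simp: quot_vimage_def)
  then have "P +> f x \<in> J" using J induced_map_coset[OF x(1)] by auto
  then show "y \<in> quot_vimage J" using x f_closed by (simp add: quot_vimage_def)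
qed

lemma quot_ideal_coset:
  assumes "ideal J (A Quot P)" "X \<in> J"
  shows "\<exists>x\<in>carrier A. X = P +> x"
  using ideal.Icarr[OF assms] unfolding carrier_quot by (rule imageE) auto

text \<open>From \<open>P +> x = P +> f z\<close> one only gets
  \<open>x \<ominus> f z \<in> P\<close>. As \<open>f\<close> maps \<open>P\<close> onto
  \<open>P\<close>, this difference is some \<open>f p\<close>, and
  \<open>x = f (p \<oplus> z)\<close>.\<close>

lemma quot_vimage_stable_eq:
  assumes J: "ideal J (A Quot P)" and st: "induced_map A P f ` J = J" and fP: "f ` P = P"
  shows "f ` quot_vimage J = quot_vimage J"
proof
  show "f ` quot_vimage J \<subseteq> quot_vimage J" using quot_vimage_stable st by simp
  show "quot_vimage J \<subseteq> f ` quot_vimage J"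
  proof
    fix x assume x: "x \<in> quot_vimage J"
    then have xc: "x \<in> carrier A" and "P +> x \<in> induced_map A P f ` J" using st by (auto simp: quot_vimage_def)
    then obtain z where z: "z \<in> carrier A" "P +> z \<in> J" "P +> x = P +> f z"
      using quot_ideal_coset[OF J] induced_map_coset by (metis imageE)
    then have "x \<ominus> f z \<in> P" using coset_eq xc f_closed by simp
    then obtain p where p: "p \<in> P" "x \<ominus> f z = f p" using fP by blast
    have pc: "p \<in> carrier A" using p(1) by (rule a_Hcarr)
    have "x = (x \<ominus> f z) \<oplus> f z" using xc f_closed[OF z(1)] by algebra
    then have "x = f (p \<oplus> z)" using p(2) f_add pc z(1) by simp
    moreover have "p \<in> quot_vimage J" "z \<in> quot_vimage J" using quot_vimage_superset[OF J] p(1) z by (auto simp: quot_vimage_def)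
    then have "p \<oplus> z \<in> quot_vimage J"
      using additive_subgroup.a_closed[OF ideal.axioms(1)[OF quot_vimage_ideal[OF J]]] by blast
    ultimately show "x \<in> f ` quot_vimage J" by blast
  qed
qed

lemma quot_vimage_subset_imp_zero: "ideal J (A Quot P) \<Longrightarrow> quot_vimage J \<subseteq> P \<Longrightarrow> J = {\<zero>\<^bsub>A Quot P\<^esub>}"
proof
  assume J: "ideal J (A Quot P)" and *: "quot_vimage J \<subseteq> P"
  show "J \<subseteq> {\<zero>\<^bsub>A Quot P\<^esub>}"
  proof
    fix X assume "X \<in> J"
    moreover from this obtain x where "x \<in> carrier A" "X = P +> x" using quot_ideal_coset[OF J] by blast
    ultimately show "X \<in> {\<zero>\<^bsub>A Quot P\<^esub>}" using * by (auto simp: quot_vimage_def zero_quot a_rcos_const)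
  qed
qed (simp add: zero_quot zero_in_quot_ideal)

lemma quot_vimage_mult:
  assumes "ideal_prod (A Quot P) J K = {\<zero>\<^bsub>A Quot P\<^esub>}" "a \<in> quot_vimage J" "b \<in> quot_vimage K"
  shows "a \<otimes> b \<in> P"
proof -
  have "(P +> a) \<otimes>\<^bsub>A Quot P\<^esub> (P +> b) \<in> ideal_prod (A Quot P) J K"
    using assms by (intro ideal_prod.prod) (auto simp: quot_vimage_def)
  then show ?thesis using assms by (simp add: mult_quot quot_vimage_def coset_P zero_quot)
qed

section \<open>Images of ideals in the quotient\<close>

lemma image_ideal: "ideal B A \<Longrightarrow> ideal ((+>) P ` B) (A Quot P)"
  by (rule ring_ideal_imp_quot_ideal[OF is_ideal])

lemma image_stable: "ideal B A \<Longrightarrow> induced_map A P f ` (+>) P ` B = (+>) P ` f ` B"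
  unfolding image_image by (intro image_cong refl induced_map_coset) (rule ideal.Icarr)

lemma image_eq_zero: "ideal B A \<Longrightarrow> (+>) P ` B = {\<zero>\<^bsub>A Quot P\<^esub>} \<Longrightarrow> B \<subseteq> P"
proof
  fix x assume B: "ideal B A" "(+>) P ` B = {\<zero>\<^bsub>A Quot P\<^esub>}" and x: "x \<in> B"
  then have "P +> x = P" unfolding zero_quot by blast
  then show "x \<in> P" using coset_P[OF ideal.Icarr[OF B(1) x]] by blast
qed

lemma image_prod:
  assumes B: "ideal B A" and C: "ideal C A" and BC: "\<And>b c. b \<in> B \<Longrightarrow> c \<in> C \<Longrightarrow> b \<otimes> c \<in> P"
  shows "ideal_prod (A Quot P) ((+>) P ` B) ((+>) P ` C) = {\<zero>\<^bsub>A Quot P\<^esub>}"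
proof
  interpret Q: ring "A Quot P" by (rule quotient_is_ring)
  show "ideal_prod (A Quot P) ((+>) P ` B) ((+>) P ` C) \<subseteq> {\<zero>\<^bsub>A Quot P\<^esub>}"
  proof
    fix x assume "x \<in> ideal_prod (A Quot P) ((+>) P ` B) ((+>) P ` C)"
    then show "x \<in> {\<zero>\<^bsub>A Quot P\<^esub>}"
    proof induction
      case (prod i j)
      then obtain b c where "b \<in> B" "c \<in> C" "i = P +> b" "j = P +> c" by blast
      then show ?case
        using BC ideal.Icarr[OF B] ideal.Icarr[OF C] by (simp add: mult_quot zero_quot a_rcos_const)
    qed auto
  qed
  show "{\<zero>\<^bsub>A Quot P\<^esub>} \<subseteq> ideal_prod (A Quot P) ((+>) P ` B) ((+>) P ` C)"
    using Q.ideal_prod_is_ideal[OF image_ideal[OF B] image_ideal[OF C]]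
    by (simp add: additive_subgroup.zero_closed ideal.axioms(1))
qed

lemma quot_nontrivial: "P \<noteq> carrier A \<Longrightarrow> carrier (A Quot P) \<noteq> {\<zero>\<^bsub>A Quot P\<^esub>}"
proof
  assume "P \<noteq> carrier A" and *: "carrier (A Quot P) = {\<zero>\<^bsub>A Quot P\<^esub>}"
  then obtain x where x: "x \<in> carrier A" "x \<notin> P" using a_subset by blast
  then have "P +> x \<in> {P}" using * unfolding carrier_quot zero_quot by blast
  then show False using x coset_P by simp
qed

end

lemma quot_endoI:
  assumes "ideal P A" "f \<in> carrier A \<rightarrow> carrier A"
    "\<And>x y. x \<in> carrier A \<Longrightarrow> y \<in> carrier A \<Longrightarrow> f (x \<oplus>\<^bsub>A\<^esub> y) = f x \<oplus>\<^bsub>A\<^esub> f y" "f ` P \<subseteq> P"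
  shows "quot_endo P A f"
  using assms by (auto simp: quot_endo_def quot_endo_axioms_def)

text \<open>Ideals of the quotient correspond to ideals containing \<open>P\<close>, and a product
  of ideals vanishes modulo \<open>P\<close> exactly when all products of elements lie in
  \<open>P\<close>. The criterion removes cosets and ideal products from the arguments that
  follow.\<close>

lemma alpha_prime_ideal_iff:
  assumes hom: "\<alpha> \<in> ring_hom A A"
  shows "alpha_prime_ideal A \<alpha> P \<longleftrightarrow> alpha_ideal A \<alpha> P \<and> P \<noteq> carrier A \<and>
    (\<forall>B C. alpha_ideal A \<alpha> B \<and> alpha_ideal A \<alpha> C \<and> P \<subseteq> B \<and> P \<subseteq> C \<and>
       (\<forall>b\<in>B. \<forall>c\<in>C. b \<otimes>\<^bsub>A\<^esub> c \<in> P) \<longrightarrow> B = P \<or> C = P)" (is "_ \<longleftrightarrow> ?st \<and> ?pr \<and> ?prime")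
proof (cases "?st \<and> ?pr")
  case True
  then have P: "ideal P A" "\<alpha> ` P \<subseteq> P" "P \<noteq> carrier A" by (auto simp: alpha_ideal_def)
  interpret quot_endo P A \<alpha>
    using P hom by (intro quot_endoI) (auto simp: ring_hom_def)
  have "alpha_prime_ring (A Quot P) (induced_map A P \<alpha>) \<longleftrightarrow> ?prime"
  proof
    assume pr: "alpha_prime_ring (A Quot P) (induced_map A P \<alpha>)"
    show ?prime
    proof (intro allI impI, elim conjE)
      fix B C
      assume B: "alpha_ideal A \<alpha> B" and C: "alpha_ideal A \<alpha> C" and sub: "P \<subseteq> B" "P \<subseteq> C"
        and BC: "\<forall>b\<in>B. \<forall>c\<in>C. b \<otimes>\<^bsub>A\<^esub> c \<in> P"
      have "alpha_ideal (A Quot P) (induced_map A P \<alpha>) ((+>\<^bsub>A\<^esub>) P ` D)" if "alpha_ideal A \<alpha> D" for D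
        using that image_ideal[of D] image_stable[of D] by (auto simp: alpha_ideal_def)
      moreover have "ideal_prod (A Quot P) ((+>\<^bsub>A\<^esub>) P ` B) ((+>\<^bsub>A\<^esub>) P ` C) = {\<zero>\<^bsub>A Quot P\<^esub>}"
        using B C BC by (intro image_prod) (auto simp: alpha_ideal_def)
      ultimately have "(+>\<^bsub>A\<^esub>) P ` B = {\<zero>\<^bsub>A Quot P\<^esub>} \<or> (+>\<^bsub>A\<^esub>) P ` C = {\<zero>\<^bsub>A Quot P\<^esub>}"
        using pr[unfolded alpha_prime_ring_def, THEN conjunct2, rule_format,
            of "(+>\<^bsub>A\<^esub>) P ` B" "(+>\<^bsub>A\<^esub>) P ` C"] B C by metis
      then show "B = P \<or> C = P"
        using image_eq_zero[of B] image_eq_zero[of C] B C sub unfolding alpha_ideal_def by auto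
    qed
  next
    assume pr: ?prime
    show "alpha_prime_ring (A Quot P) (induced_map A P \<alpha>)"
      unfolding alpha_prime_ring_def
    proof (intro conjI allI impI notI; (elim conjE)?)
      fix J K
      assume J: "alpha_ideal (A Quot P) (induced_map A P \<alpha>) J"
        and K: "alpha_ideal (A Quot P) (induced_map A P \<alpha>) K"
        and nz: "J \<noteq> {\<zero>\<^bsub>A Quot P\<^esub>}" "K \<noteq> {\<zero>\<^bsub>A Quot P\<^esub>}"
        and JK: "ideal_prod (A Quot P) J K = {\<zero>\<^bsub>A Quot P\<^esub>}"
      have "alpha_ideal A \<alpha> (quot_vimage D) \<and> P \<subseteq> quot_vimage D"
        if "alpha_ideal (A Quot P) (induced_map A P \<alpha>) D" for D
        using that quot_vimage_ideal[of D] quot_vimage_stable[of D] quot_vimage_superset[of D]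
        unfolding alpha_ideal_def by simp
      then have "quot_vimage J = P \<or> quot_vimage K = P"
        using pr[rule_format, of "quot_vimage J" "quot_vimage K"] J K quot_vimage_mult[OF JK] by simp
      then show False
        using quot_vimage_subset_imp_zero[of J] quot_vimage_subset_imp_zero[of K] J K nz
        unfolding alpha_ideal_def by auto
    qed (use quot_nontrivial P in blast)
  qed
  then show ?thesis using True by (simp add: alpha_prime_ideal_def)
qed (auto simp: alpha_prime_ideal_def)

text \<open>The same correspondence; equality under \<open>\<tau>\<close> passes to preimages
  because \<open>\<tau>\<close> maps \<open>P\<close> onto itself.\<close>

lemma tau_delta_prime_ideal_iff:
  assumes ring: "ring A" and hom: "\<tau> \<in> ring_hom A A" and der: "left_skew_derivation A \<tau> \<delta>"
  shows "tau_delta_prime_ideal A \<tau> \<delta> P \<longleftrightarrow> tau_delta_ideal A \<tau> \<delta> P \<and> P \<noteq> carrier A \<and>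
    (\<forall>B C. tau_delta_ideal A \<tau> \<delta> B \<and> tau_delta_ideal A \<tau> \<delta> C \<and> P \<subseteq> B \<and> P \<subseteq> C \<and>
       (\<forall>b\<in>B. \<forall>c\<in>C. b \<otimes>\<^bsub>A\<^esub> c \<in> P) \<longrightarrow> B = P \<or> C = P)" (is "_ \<longleftrightarrow> ?st \<and> ?pr \<and> ?prime")
proof (cases "?st \<and> ?pr")
  case True
  then have P: "ideal P A" "\<tau> ` P = P" "\<delta> ` P \<subseteq> P" "P \<noteq> carrier A" by (auto simp: tau_delta_ideal_def)
  interpret t: quot_endo P A \<tau>
    using P hom by (intro quot_endoI) (auto simp: ring_hom_def)
  interpret d: quot_endo P A \<delta>
    using P der by (intro quot_endoI) (auto simp: left_skew_derivation_def)
  let ?t = "induced_map A P \<tau>" and ?d = "induced_map A P \<delta>"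
  have "tau_delta_prime_ring (A Quot P) ?t ?d \<longleftrightarrow> ?prime"
  proof
    assume pr: "tau_delta_prime_ring (A Quot P) ?t ?d"
    show ?prime
    proof (intro allI impI, elim conjE)
      fix B C
      assume B: "tau_delta_ideal A \<tau> \<delta> B" and C: "tau_delta_ideal A \<tau> \<delta> C" and sub: "P \<subseteq> B" "P \<subseteq> C"
        and BC: "\<forall>b\<in>B. \<forall>c\<in>C. b \<otimes>\<^bsub>A\<^esub> c \<in> P"
      have "tau_delta_ideal (A Quot P) ?t ?d ((+>\<^bsub>A\<^esub>) P ` D)" if "tau_delta_ideal A \<tau> \<delta> D" for D
        using that t.image_ideal[of D] t.image_stable[of D] d.image_stable[of D]
        by (auto simp: tau_delta_ideal_def)
      moreover have "ideal_prod (A Quot P) ((+>\<^bsub>A\<^esub>) P ` B) ((+>\<^bsub>A\<^esub>) P ` C) = {\<zero>\<^bsub>A Quot P\<^esub>}"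
        using B C BC by (intro t.image_prod) (auto simp: tau_delta_ideal_def)
      ultimately have "(+>\<^bsub>A\<^esub>) P ` B = {\<zero>\<^bsub>A Quot P\<^esub>} \<or> (+>\<^bsub>A\<^esub>) P ` C = {\<zero>\<^bsub>A Quot P\<^esub>}"
        using pr[unfolded tau_delta_prime_ring_def, rule_format,
            of "(+>\<^bsub>A\<^esub>) P ` B" "(+>\<^bsub>A\<^esub>) P ` C"] B C by metis
      then show "B = P \<or> C = P"
        using t.image_eq_zero[of B] t.image_eq_zero[of C] B C sub unfolding tau_delta_ideal_def by auto
    qed
  next
    assume pr: ?prime
    show "tau_delta_prime_ring (A Quot P) ?t ?d"
      unfolding tau_delta_prime_ring_def
    proof (intro allI impI notI, elim conjE)
      fix J K
      assume J: "tau_delta_ideal (A Quot P) ?t ?d J" and K: "tau_delta_ideal (A Quot P) ?t ?d K"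
        and nz: "J \<noteq> {\<zero>\<^bsub>A Quot P\<^esub>}" "K \<noteq> {\<zero>\<^bsub>A Quot P\<^esub>}"
        and JK: "ideal_prod (A Quot P) J K = {\<zero>\<^bsub>A Quot P\<^esub>}"
      \<comment> \<open>The definition of \<open>quot_vimage\<close> does not involve the map, so
        both interpretations give the same set and their stability results can be combined.\<close>
      have "tau_delta_ideal A \<tau> \<delta> (t.quot_vimage D) \<and> P \<subseteq> t.quot_vimage D"
        if "tau_delta_ideal (A Quot P) ?t ?d D" for D
        using that t.quot_vimage_ideal[of D] t.quot_vimage_stable_eq[of D, OF _ _ P(2)] d.quot_vimage_stable[of D]
          t.quot_vimage_superset[of D]
        unfolding tau_delta_ideal_def by simp
      then have "t.quot_vimage J = P \<or> t.quot_vimage K = P"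
        using pr[rule_format, of "t.quot_vimage J" "t.quot_vimage K"] J K t.quot_vimage_mult[OF JK] by simp
      then show False
        using t.quot_vimage_subset_imp_zero[of J] t.quot_vimage_subset_imp_zero[of K] J K nz
        unfolding tau_delta_ideal_def by auto
    qed
  qed
  then show ?thesis using True by (simp add: tau_delta_prime_ideal_def)
qed (auto simp: tau_delta_prime_ideal_def)

section \<open>Lifting and contracting prime ideals\<close>

locale skew_noetherian = skew_adic_ring +
  fixes \<sigma> :: "(nat \<Rightarrow> 'a) \<Rightarrow> nat \<Rightarrow> 'a"
  assumes noeth: "right_noetherian (gr_ring R I)"
    and sigma_hom: "\<sigma> \<in> ring_hom (skew_power_series R I \<tau> \<delta>) (skew_power_series R I \<tau> \<delta>)"
    and sigma_const: "r \<in> carrier R \<Longrightarrow> \<sigma> (const_series R r) = const_series R (\<tau> r)"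
begin

section \<open>Series with coefficients in a stable ideal\<close>

sublocale T: ring T by (rule ring_T)

text \<open>The two inclusions are what makes \<open>K[[y]]\<close> absorb multiplication by
  \<open>y\<close> from the left.\<close>

definition skew_stable :: "'a set \<Rightarrow> bool" where
  "skew_stable K \<longleftrightarrow> ideal K R \<and> \<tau> ` K \<subseteq> K \<and> \<delta> ` K \<subseteq> K"

lemma tau_delta_ideal_skew_stable: "tau_delta_ideal R \<tau> \<delta> K \<Longrightarrow> skew_stable K"
  by (auto simp: tau_delta_ideal_def skew_stable_def)

lemma ideal_right_ideal: "ideal K R \<Longrightarrow> right_ideal K R"
  by (auto simp: right_ideal_def ideal.axioms(1) ideal.I_r_closed)

lemma adic_sums_ideal: "ideal K R \<Longrightarrow> adic_sums s l \<Longrightarrow> (\<And>i. s i \<in> K) \<Longrightarrow> l \<in> K"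
  using right_ideal_closed[OF noeth ideal_right_ideal] .

text \<open>This is \<open>K[[y]]\<close>; it equals \<open>K T\<close> because \<open>K\<close> is finitely generated as a right ideal, and this
  is why it is \<open>\<sigma>\<close>-stable although no continuity of \<open>\<sigma>\<close> is assumed.\<close>

definition coeff_ideal :: "'a set \<Rightarrow> (nat \<Rightarrow> 'a) set" where
  "coeff_ideal K = {f \<in> carrier T. \<forall>n. f n \<in> K}"

lemma Y_pow_coeff_ideal: "skew_stable K \<Longrightarrow> f \<in> coeff_ideal K \<Longrightarrow> (Y ^^ i) f n \<in> K"
proof (induction i arbitrary: n)
  case 0
  then show ?case by (simp add: coeff_ideal_def)
next
  case (Suc i)
  have K: "ideal K R" "\<tau> ` K \<subseteq> K" "\<delta> ` K \<subseteq> K" using Suc.prems by (auto simp: skew_stable_def)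
  have "(if n = 0 then \<zero> else \<tau> ((Y ^^ i) f (n - 1))) \<in> K"
    using K Suc additive_subgroup.zero_closed[OF ideal.axioms(1)[OF K(1)]] by auto
  moreover have "\<delta> ((Y ^^ i) f n) \<in> K" using K Suc by blast
  ultimately show ?case
    using additive_subgroup.a_closed[OF ideal.axioms(1)[OF K(1)]]
    by (simp add: y_times_def[of R \<tau> \<delta> "(Y ^^ i) f"])
qed

text \<open>Stability of \<open>B\<close> keeps \<open>(Y^i g) n\<close> in \<open>B\<close>, so
  each coefficient is the sum of a series with terms in \<open>K\<close>, and \<open>K\<close> is
  closed. Taking \<open>A\<close> or \<open>B\<close> to be the whole ring gives the ideal property
  of \<open>K[[y]]\<close>; taking \<open>K\<close> to be a contraction gives the product estimate
  for primes.\<close>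

lemma coeff_ideal_mult:
  assumes A: "f \<in> coeff_ideal A" and B: "skew_stable B" "g \<in> coeff_ideal B" and K: "ideal K R"
    and AB: "\<And>a b. a \<in> A \<Longrightarrow> b \<in> B \<Longrightarrow> a \<otimes> b \<in> K"
  shows "f \<otimes>\<^bsub>T\<^esub> g \<in> coeff_ideal K"
proof -
  have f: "f \<in> carrier T" "f i \<in> A" for i using A by (auto simp: coeff_ideal_def)
  have g: "g \<in> carrier T" using B by (auto simp: coeff_ideal_def)
  have "(f \<otimes>\<^bsub>T\<^esub> g) n \<in> K" for n
    using K sums_mult_T[OF f(1) g] AB[OF f(2) Y_pow_coeff_ideal[OF B]] by (rule adic_sums_ideal)
  then show ?thesis using f g by (simp add: coeff_ideal_def)
qed

lemma skew_stable_carrier: "skew_stable (carrier R)"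
  by (auto simp: skew_stable_def oneideal)

lemma coeff_ideal_carrier: "coeff_ideal (carrier R) = carrier T"
  by (auto simp: coeff_ideal_def carrier_T)

lemma a_inv_T: "f \<in> carrier T \<Longrightarrow> \<ominus>\<^bsub>T\<^esub> f = (\<lambda>n. \<ominus> f n)"
  by (rule T.minus_equality) (auto simp: carrier_T fun_eq_iff l_neg)

lemma coeff_ideal_ideal:
  assumes "skew_stable K"
  shows "ideal (coeff_ideal K) T"
proof (rule idealI)
  have K: "ideal K R" using assms by (simp add: skew_stable_def)
  interpret K: ideal K R by fact
  show "subgroup (coeff_ideal K) (add_monoid T)"
  proof (rule T.add.subgroupI)
    have "\<zero>\<^bsub>T\<^esub> \<in> coeff_ideal K" by (simp add: coeff_ideal_def)
    then show "coeff_ideal K \<noteq> {}" by blast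
  qed (auto simp: coeff_ideal_def a_inv_T carrier_T)
  fix f g assume f: "f \<in> coeff_ideal K" and g: "g \<in> carrier T"
  show "g \<otimes>\<^bsub>T\<^esub> f \<in> coeff_ideal K"
    using g by (intro coeff_ideal_mult[OF _ assms f K, of _ "carrier R"])
      (auto simp: coeff_ideal_carrier K.I_l_closed)
  show "f \<otimes>\<^bsub>T\<^esub> g \<in> coeff_ideal K"
    using g by (intro coeff_ideal_mult[OF f skew_stable_carrier _ K])
      (auto simp: coeff_ideal_carrier K.I_r_closed)
qed (rule ring_T)

lemma const_coeff_ideal: "ideal K R \<Longrightarrow> const_series R r \<in> coeff_ideal K \<longleftrightarrow> r \<in> K"
  using ideal.Icarr[of K R] additive_subgroup.zero_closed[OF ideal.axioms(1), of K R]
  by (auto simp: coeff_ideal_def monomial_def carrier_T)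

lemma const_hom: "const_series R \<in> ring_hom R T"
proof (rule ring_hom_memI)
  fix x y assume "x \<in> carrier R" "y \<in> carrier R"
  then show "const_series R (x \<otimes> y) = const_series R x \<otimes>\<^bsub>T\<^esub> const_series R y"
    by (simp add: const_mult fun_eq_iff) (simp add: monomial_def)
  show "const_series R (x \<oplus> y) = const_series R x \<oplus>\<^bsub>T\<^esub> const_series R y"
    by (auto simp: monomial_def fun_eq_iff)
qed (auto simp: one_T)

lemma finsum_T: "(\<And>p. p \<in> F \<Longrightarrow> g p \<in> carrier T) \<Longrightarrow> (\<Oplus>\<^bsub>T\<^esub>p\<in>F. g p) n = (\<Oplus>p\<in>F. g p n)"
proof (induction F rule: infinite_finite_induct)
  case (insert x F)
  then have "g \<in> F \<rightarrow> carrier T" "g x \<in> carrier T" "(\<lambda>p. g p n) \<in> F \<rightarrow> carrier R" "g x n \<in> carrier R"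
    by (auto simp: T_coeff)
  then show ?case using insert by simp
qed auto

text \<open>\<open>K[[y]]\<close> is the smallest ideal of \<open>T\<close> containing the constants
  from \<open>K\<close>: all coefficients are expanded in one finite generating set, and the powers
  of \<open>y\<close> are collected behind each generator.\<close>

lemma coeff_ideal_subset:
  assumes K: "ideal K R" and J: "ideal J T" and KJ: "\<And>r. r \<in> K \<Longrightarrow> const_series R r \<in> J"
  shows "coeff_ideal K \<subseteq> J"
proof
  interpret J: ideal J T by fact
  fix f assume "f \<in> coeff_ideal K"
  then have f: "f \<in> carrier T" "\<And>n. f n \<in> K" by (auto simp: coeff_ideal_def)
  obtain F :: "('a \<times> nat) set" where F: "finite F" "fst ` F \<subseteq> K"
    and gen: "\<And>x. x \<in> adic_closure K \<Longrightarrow> \<exists>c. (\<forall>p\<in>F. c p \<in> carrier R) \<and> x = comb F c"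
    using adic_closure_fin_gen[OF noeth ideal_right_ideal[OF K]] by metis
  have Kc: "K \<subseteq> carrier R" using ideal.Icarr[OF K] by blast
  have "\<exists>c. (\<forall>p\<in>F. c p \<in> carrier R) \<and> f n = comb F c" for n
    using gen f(2) subset_adic_closure[OF Kc] by blast
  \<comment> \<open>The expansions are chosen independently for each \<open>n\<close>. This is
    harmless, since every sequence in \<open>R\<close> is an element of \<open>T\<close>;
    \<open>?g p\<close> collects the coefficients belonging to \<open>p\<close>.\<close>
  then obtain c where c: "\<And>n p. p \<in> F \<Longrightarrow> c n p \<in> carrier R" "\<And>n. f n = comb F (c n)" by metis
  let ?g = "\<lambda>p n. c n p"
  have g: "?g p \<in> carrier T" if "p \<in> F" for p using c(1)[OF that] by (simp add: carrier_T)
  have Fc: "fst p \<in> carrier R" if "p \<in> F" for p using that F(2) Kc by blast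
  have mem: "const_series R (fst p) \<otimes>\<^bsub>T\<^esub> ?g p \<in> J" if "p \<in> F" for p
    using J.I_r_closed[OF KJ g[OF that]] F(2) that by blast
  have "f = (\<Oplus>\<^bsub>T\<^esub>p\<in>F. const_series R (fst p) \<otimes>\<^bsub>T\<^esub> ?g p)"
  proof
    fix n
    have "(\<Oplus>\<^bsub>T\<^esub>p\<in>F. const_series R (fst p) \<otimes>\<^bsub>T\<^esub> ?g p) n
        = (\<Oplus>p\<in>F. (const_series R (fst p) \<otimes>\<^bsub>T\<^esub> ?g p) n)"
      using mem J.a_Hcarr by (intro finsum_T) auto
    also have "\<dots> = comb F (c n)"
      using g Fc c(1) by (intro finsum_cong') (auto simp: const_mult)
    finally show "f n = (\<Oplus>\<^bsub>T\<^esub>p\<in>F. const_series R (fst p) \<otimes>\<^bsub>T\<^esub> ?g p) n" by (simp add: c(2))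
  qed
  moreover have "(\<Oplus>\<^bsub>T\<^esub>p\<in>H. const_series R (fst p) \<otimes>\<^bsub>T\<^esub> ?g p) \<in> J" if "H \<subseteq> F" for H
    using that
  proof (induction H rule: infinite_finite_induct)
    case (insert x H)
    then show ?case using mem J.a_Hcarr by (subst T.finsum_insert) auto
  qed auto
  ultimately show "f \<in> J" by auto
qed

text \<open>The preimage of \<open>K[[y]]\<close> under \<open>\<sigma>\<close> is an ideal of
  \<open>T\<close> and contains the constants from \<open>K\<close>, on which
  \<open>\<sigma>\<close> acts as \<open>\<tau>\<close>. By minimality of \<open>K[[y]]\<close> it
  contains \<open>K[[y]]\<close>.\<close>

lemma coeff_ideal_alpha:
  assumes "skew_stable K"
  shows "alpha_ideal T \<sigma> (coeff_ideal K)"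
proof -
  have K: "ideal K R" "\<tau> ` K \<subseteq> K" using assms by (auto simp: skew_stable_def)
  interpret s: ring_hom_ring T T \<sigma>
    using sigma_hom ring_T by (simp add: ring_hom_ringI2)
  have "coeff_ideal K \<subseteq> {f \<in> carrier T. \<sigma> f \<in> coeff_ideal K}"
    using K ideal.Icarr[OF K(1)]
    by (intro coeff_ideal_subset s.ideal_vimage coeff_ideal_ideal assms)
      (auto simp: sigma_const const_coeff_ideal)
  then show ?thesis using coeff_ideal_ideal[OF assms] by (auto simp: alpha_ideal_def)
qed

text \<open>The right ideals \<open>\<tau>\<^sup>-\<^sup>n K\<close> form an ascending chain.\<close>

lemma tau_stable_eq:
  assumes K: "ideal K R" and st: "\<tau> ` K \<subseteq> K"
  shows "\<tau> ` K = K"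
proof
  show "K \<subseteq> \<tau> ` K"
  proof
    fix x assume x: "x \<in> K"
    have Kc: "K \<subseteq> carrier R" using ideal.Icarr[OF K] by blast
    interpret t: ring_hom_ring R R \<tau> using tau_hom ring_axioms by (simp add: ring_hom_ringI2)
    define L where "L n = {x \<in> carrier R. (\<tau> ^^ n) x \<in> K}" for n
    have LS: "L (Suc n) = {x \<in> carrier R. \<tau> x \<in> L n}" for n
      by (auto simp: L_def funpow_Suc_right simp del: funpow.simps)
    have "ideal (L n) R" for n
    proof (induction n)
      case 0
      have "L 0 = K" using Kc by (auto simp: L_def)
      then show ?case using K by simp
    next
      case (Suc n)
      then show ?case unfolding LS by (rule t.ideal_vimage)
    qed
    then have "\<exists>N. \<forall>n. L n \<subseteq> L N"
      using st by (intro right_ideal_acc[OF noeth ideal_right_ideal]) (auto simp: L_def)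
    then obtain N where N: "\<And>n. L n \<subseteq> L N" by blast
    have surj: "\<exists>z\<in>carrier R. (\<tau> ^^ n) z = w" if "w \<in> carrier R" for w n
      using that
    proof (induction n arbitrary: w)
      case (Suc n)
      have "\<tau> ` carrier R = carrier R" using tau_iso by (simp add: ring_iso_def bij_betw_def)
      then obtain v where "v \<in> carrier R" "\<tau> v = w" using Suc.prems by (metis imageE)
      then show ?case using Suc.IH[of v] by auto
    qed auto
    \<comment> \<open>\<open>x\<close> is pulled back one step further than \<open>N\<close>. Then
      \<open>z \<in> L (Suc N) \<subseteq> L N\<close>, so \<open>\<tau>^N z\<close> lies in
      \<open>K\<close> and is mapped to \<open>x\<close> by \<open>\<tau>\<close>.\<close>
    obtain z where z: "z \<in> carrier R" "(\<tau> ^^ Suc N) z = x" using surj x Kc by blast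
    then have "z \<in> L N" using N[of "Suc N"] x by (auto simp: L_def)
    then show "x \<in> \<tau> ` K" using z by (auto simp: L_def)
  qed
qed (rule st)

section \<open>Contraction to the coefficient ring\<close>

lemma y_mult_T:
  assumes b: "b \<in> carrier T"
  shows "skew_y R \<otimes>\<^bsub>T\<^esub> b = Y b"
proof (rule mult_T_eqI)
  fix n
  have "(\<lambda>i. skew_y R i \<otimes> (Y ^^ i) b n) = (\<lambda>i. if i = 1 then Y b n else \<zero>)"
    using b Y_pow_coeff[OF b, of 1 n] by (auto simp: monomial_def fun_eq_iff)
  then show "adic_sums (\<lambda>i. skew_y R i \<otimes> (Y ^^ i) b n) (Y b n)"
    using adic_sums_single[of "Y b n" 1] Y_closed[OF b] by (simp add: T_coeff)
qed (use b in auto)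

lemma contraction_tau_delta:
  assumes P: "alpha_ideal T \<sigma> P"
  shows "tau_delta_ideal R \<tau> \<delta> (contraction R P)"
proof -
  interpret P: ideal P T using P by (simp add: alpha_ideal_def)
  interpret c: ring_hom_ring R T "const_series R"
    using const_hom ring_T ring_axioms by (simp add: ring_hom_ringI2)
  have id: "ideal (contraction R P) R"
    unfolding contraction_def by (rule c.ideal_vimage[OF P.is_ideal])
  have tau: "\<tau> ` contraction R P \<subseteq> contraction R P"
    using P sigma_const by (force simp: contraction_def alpha_ideal_def)
  have "\<delta> q \<in> contraction R P" if "q \<in> contraction R P" for q
  proof -
    have q: "q \<in> carrier R" "const_series R q \<in> P" using that by (auto simp: contraction_def)
    have "const_series R (\<tau> q) \<in> P" using that tau by (auto simp: contraction_def)
    then have 1: "const_series R (\<tau> q) \<otimes>\<^bsub>T\<^esub> skew_y R \<in> P" by (simp add: P.I_r_closed)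
    have 2: "skew_y R \<otimes>\<^bsub>T\<^esub> const_series R q \<in> P" using q by (simp add: P.I_l_closed)
    have "skew_y R \<otimes>\<^bsub>T\<^esub> const_series R q
        = const_series R (\<delta> q) \<oplus>\<^bsub>T\<^esub> const_series R (\<tau> q) \<otimes>\<^bsub>T\<^esub> skew_y R"
      unfolding y_mult_T[OF monomial_T[OF q(1)]]
        const_mult[OF tau_closed[OF q(1)] monomial_T[OF one_closed]]
      using q(1) by (auto simp: y_times_def monomial_def fun_eq_iff)
    moreover have "const_series R (\<delta> q) \<in> carrier T" using q by simp
    ultimately have "const_series R (\<delta> q)
        = skew_y R \<otimes>\<^bsub>T\<^esub> const_series R q \<ominus>\<^bsub>T\<^esub> const_series R (\<tau> q) \<otimes>\<^bsub>T\<^esub> skew_y R"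
      using P.a_Hcarr[OF 1] by (simp add: a_minus_def T.a_assoc T.r_neg)
    then have "const_series R (\<delta> q) \<in> P"
      using 1 2 P.a_inv_closed T.is_abelian_group by (simp add: a_minus_def)
    then show ?thesis using q by (simp add: contraction_def)
  qed
  \<comment> \<open>So far \<open>\<tau>\<close> only maps the contraction into itself;
    \<open>tau_stable_eq\<close> supplies the equality that a
    \<open>\<tau>\<close>-\<open>\<delta>\<close>-ideal demands.\<close>
  then show ?thesis
    using id tau tau_stable_eq by (auto simp: tau_delta_ideal_def)
qed

lemma contraction_mono: "P \<subseteq> P' \<Longrightarrow> contraction R P \<subseteq> contraction R P'"
  by (auto simp: contraction_def)

lemma contraction_coeff_ideal: "ideal K R \<Longrightarrow> contraction R (coeff_ideal K) = K"
  using ideal.Icarr by (auto simp: contraction_def const_coeff_ideal)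

lemma contraction_proper: "ideal P T \<Longrightarrow> contraction R P = carrier R \<longleftrightarrow> P = carrier T"
proof
  assume "ideal P T" "contraction R P = carrier R"
  then show "P = carrier T"
    using ideal.one_imp_carrier[of P T] by (auto simp: contraction_def one_T)
qed (auto simp: contraction_def)

theorem exists_prime_over:
  assumes Q: "tau_delta_prime_ideal R \<tau> \<delta> Q"
  shows "\<exists>P. alpha_prime_ideal T \<sigma> P \<and> contraction R P = Q"
proof -
  note Qiff = tau_delta_prime_ideal_iff[OF ring_axioms tau_hom deriv, of Q]
  have Q1: "tau_delta_ideal R \<tau> \<delta> Q" "Q \<noteq> carrier R"
    and Qp: "\<And>B C. tau_delta_ideal R \<tau> \<delta> B \<Longrightarrow> tau_delta_ideal R \<tau> \<delta> C \<Longrightarrow> Q \<subseteq> B \<Longrightarrow> Q \<subseteq> C \<Longrightarrow>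
       (\<forall>b\<in>B. \<forall>c\<in>C. b \<otimes> c \<in> Q) \<Longrightarrow> B = Q \<or> C = Q"
    using Q unfolding Qiff by blast+
  have Qid: "ideal Q R" using Q1 by (simp add: tau_delta_ideal_def)
  define \<A> where "\<A> = {P. alpha_ideal T \<sigma> P \<and> contraction R P = Q}"
  have ne: "coeff_ideal Q \<in> \<A>"
    using coeff_ideal_alpha[OF tau_delta_ideal_skew_stable[OF Q1(1)]] Qid
    by (simp add: \<A>_def contraction_coeff_ideal)
  have "\<exists>M\<in>\<A>. \<forall>X\<in>\<A>. M \<subseteq> X \<longrightarrow> X = M"
  proof (rule subset_Zorn_nonempty)
    fix \<C> assume \<C>: "\<C> \<noteq> {}" "subset.chain \<A> \<C>"
    have mem: "X \<in> \<A>" if "X \<in> \<C>" for X using \<C>(2) that by (auto simp: subset_chain_def)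
    have id: "ideal X T" if "X \<in> \<C>" for X using mem[OF that] by (simp add: \<A>_def alpha_ideal_def)
    have "ideal (\<Union>\<C>) T"
      using T.chain_Union_is_ideal[of \<C>] \<C> id by (auto simp: subset_chain_def)
    moreover have "\<sigma> ` \<Union>\<C> \<subseteq> \<Union>\<C>" using mem unfolding \<A>_def alpha_ideal_def by blast
    \<comment> \<open>Contraction tests one constant at a time, so it commutes with the union; as
      the chain is nonempty, the common value \<open>Q\<close> survives.\<close>
    moreover have "contraction R (\<Union>\<C>) = Q"
    proof -
      have "contraction R (\<Union>\<C>) = (\<Union>X\<in>\<C>. contraction R X)" by (auto simp: contraction_def)
      then show ?thesis using mem \<C>(1) by (auto simp: \<A>_def)
    qed
    ultimately show "\<Union>\<C> \<in> \<A>" by (simp add: \<A>_def alpha_ideal_def)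
  qed (use ne in blast)
  then obtain M where M: "alpha_ideal T \<sigma> M" "contraction R M = Q"
    and max: "\<And>X. alpha_ideal T \<sigma> X \<Longrightarrow> contraction R X = Q \<Longrightarrow> M \<subseteq> X \<Longrightarrow> X = M"
    by (auto simp: \<A>_def)
  have "alpha_prime_ideal T \<sigma> M"
    unfolding alpha_prime_ideal_iff[OF sigma_hom]
  proof (intro conjI allI impI; (elim conjE)?)
    show "M \<noteq> carrier T"
      using contraction_proper[of M] M Q1 by (auto simp: alpha_ideal_def)
    fix B C
    assume B: "alpha_ideal T \<sigma> B" and C: "alpha_ideal T \<sigma> C" and sub: "M \<subseteq> B" "M \<subseteq> C"
      and BC: "\<forall>b\<in>B. \<forall>c\<in>C. b \<otimes>\<^bsub>T\<^esub> c \<in> M"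
    have "b \<otimes> c \<in> Q" if "b \<in> contraction R B" "c \<in> contraction R C" for b c
    proof -
      have "const_series R (b \<otimes> c) \<in> M" "b \<otimes> c \<in> carrier R"
        using that BC ring_hom_mult[OF const_hom] by (auto simp: contraction_def)
      then show ?thesis using M(2) by (auto simp: contraction_def)
    qed
    then have "contraction R B = Q \<or> contraction R C = Q"
      using contraction_tau_delta[OF B] contraction_tau_delta[OF C]
        contraction_mono[OF sub(1)] contraction_mono[OF sub(2)] M(2) by (intro Qp) auto
    \<comment> \<open>Whichever of \<open>B\<close> and \<open>C\<close> contracts to
      \<open>Q\<close> competes in the maximality of \<open>M\<close>, hence equals
      \<open>M\<close>.\<close>
    then show "B = M \<or> C = M" using max B C sub by blast
  qed (rule M)
  then show ?thesis using M(2) by blast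
qed

theorem prime_contraction:
  assumes P: "alpha_prime_ideal T \<sigma> P"
  shows "tau_delta_prime_ideal R \<tau> \<delta> (contraction R P)"
proof -
  let ?Q = "contraction R P"
  have P1: "alpha_ideal T \<sigma> P" "P \<noteq> carrier T"
    and Pp: "\<And>B C. alpha_ideal T \<sigma> B \<Longrightarrow> alpha_ideal T \<sigma> C \<Longrightarrow> P \<subseteq> B \<Longrightarrow> P \<subseteq> C \<Longrightarrow>
       (\<forall>b\<in>B. \<forall>c\<in>C. b \<otimes>\<^bsub>T\<^esub> c \<in> P) \<Longrightarrow> B = P \<or> C = P"
    using P unfolding alpha_prime_ideal_iff[OF sigma_hom] by blast+
  interpret P: ideal P T using P1 by (simp add: alpha_ideal_def)
  have Q: "tau_delta_ideal R \<tau> \<delta> ?Q" using P1(1) by (rule contraction_tau_delta)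
  then have Qid: "ideal ?Q R" by (simp add: tau_delta_ideal_def)
  show ?thesis
    unfolding tau_delta_prime_ideal_iff[OF ring_axioms tau_hom deriv]
  proof (intro conjI allI impI; (elim conjE)?)
    show "?Q \<noteq> carrier R" using contraction_proper[OF P.is_ideal] P1 by simp
    fix A B
    assume A: "tau_delta_ideal R \<tau> \<delta> A" and B: "tau_delta_ideal R \<tau> \<delta> B" and sub: "?Q \<subseteq> A" "?Q \<subseteq> B"
      and AB: "\<forall>a\<in>A. \<forall>b\<in>B. a \<otimes> b \<in> ?Q"
    have QP: "coeff_ideal ?Q \<subseteq> P"
      using Qid P.is_ideal by (rule coeff_ideal_subset) (simp add: contraction_def)
    \<comment> \<open>The prime criterion speaks of ideals containing \<open>P\<close>, so
      \<open>P\<close> is added to \<open>K[[y]]\<close>.\<close>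
    define E where "E K = P <+>\<^bsub>T\<^esub> coeff_ideal K" for K
    have E: "alpha_ideal T \<sigma> (E K)" "P \<subseteq> E K" "coeff_ideal K \<subseteq> E K"
      if K: "tau_delta_ideal R \<tau> \<delta> K" for K
    proof -
      have a: "alpha_ideal T \<sigma> (coeff_ideal K)"
        using coeff_ideal_alpha[OF tau_delta_ideal_skew_stable[OF K]] .
      interpret J: ideal "coeff_ideal K" T using a by (simp add: alpha_ideal_def)
      have "\<sigma> ` E K \<subseteq> E K"
      proof
        fix x assume "x \<in> \<sigma> ` E K"
        then obtain p k where pk: "p \<in> P" "k \<in> coeff_ideal K" "x = \<sigma> (p \<oplus>\<^bsub>T\<^esub> k)"
          by (auto simp: E_def set_add_def')
        then have "x = \<sigma> p \<oplus>\<^bsub>T\<^esub> \<sigma> k" using ring_hom_add[OF sigma_hom] by simp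
        moreover have "\<sigma> p \<in> P" "\<sigma> k \<in> coeff_ideal K"
          using pk P1(1) a by (auto simp: alpha_ideal_def)
        ultimately show "x \<in> E K" by (auto simp: E_def set_add_def')
      qed
      then show "alpha_ideal T \<sigma> (E K)"
        using T.add_ideals[OF P.is_ideal J.is_ideal] by (simp add: alpha_ideal_def E_def)
      have "p \<oplus>\<^bsub>T\<^esub> \<zero>\<^bsub>T\<^esub> \<in> E K" if "p \<in> P" for p
        using that J.zero_closed unfolding E_def set_add_def' by blast
      then show "P \<subseteq> E K" using P.a_Hcarr by auto
      have "\<zero>\<^bsub>T\<^esub> \<oplus>\<^bsub>T\<^esub> k \<in> E K" if "k \<in> coeff_ideal K" for k
        using that P.zero_closed unfolding E_def set_add_def' by blast
      then show "coeff_ideal K \<subseteq> E K" using J.a_Hcarr by auto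
    qed
    have "\<forall>b\<in>E A. \<forall>c\<in>E B. b \<otimes>\<^bsub>T\<^esub> c \<in> P"
    proof (intro ballI)
      fix f g assume "f \<in> E A" "g \<in> E B"
      then obtain p a q b where f: "p \<in> P" "a \<in> coeff_ideal A" "f = p \<oplus>\<^bsub>T\<^esub> a"
        and g: "q \<in> P" "b \<in> coeff_ideal B" "g = q \<oplus>\<^bsub>T\<^esub> b"
        by (auto simp: E_def set_add_def')
      have c: "p \<in> carrier T" "q \<in> carrier T" "a \<in> carrier T" "b \<in> carrier T"
        using f g P.a_Hcarr by (auto simp: coeff_ideal_def)
      \<comment> \<open>The coefficients of this product lie in \<open>?Q\<close>, and
        \<open>P\<close> contains every series over \<open>?Q\<close> since it contains the
        constants from \<open>?Q\<close>. The other terms of the expansion have a factor in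
        \<open>P\<close>.\<close>
      have "a \<otimes>\<^bsub>T\<^esub> b \<in> P"
        using coeff_ideal_mult[OF f(2) tau_delta_ideal_skew_stable[OF B] g(2) Qid] AB QP by blast
      moreover have "p \<otimes>\<^bsub>T\<^esub> g \<in> P" "a \<otimes>\<^bsub>T\<^esub> q \<in> P"
        using f g c by (auto simp: P.I_r_closed P.I_l_closed)
      moreover have "f \<otimes>\<^bsub>T\<^esub> g = p \<otimes>\<^bsub>T\<^esub> g \<oplus>\<^bsub>T\<^esub> (a \<otimes>\<^bsub>T\<^esub> q \<oplus>\<^bsub>T\<^esub> a \<otimes>\<^bsub>T\<^esub> b)"
        using c by (simp add: f(3) g(3) T.l_distr T.r_distr T.a_ac)
      ultimately show "f \<otimes>\<^bsub>T\<^esub> g \<in> P" by simp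
    qed
    then have "E A = P \<or> E B = P" using E A B by (intro Pp) auto
    then have "coeff_ideal A \<subseteq> P \<or> coeff_ideal B \<subseteq> P" using E(3) A B by blast
    \<comment> \<open>\<open>K[[y]]\<close> contracts back to \<open>K\<close>, so its inclusion in
      \<open>P\<close> forces \<open>K \<subseteq> ?Q\<close>.\<close>
    moreover have "K = ?Q" if "coeff_ideal K \<subseteq> P" "tau_delta_ideal R \<tau> \<delta> K" "?Q \<subseteq> K" for K
      using contraction_mono[OF that(1)] contraction_coeff_ideal[of K] that
      by (auto simp: tau_delta_ideal_def)
    ultimately show "A = ?Q \<or> B = ?Q" using A B sub by blast
  qed (rule Q)
qed

end

theorem theorem3p17:
  fixes R :: "('a, 'b) ring_scheme" and I :: "'a set" and \<tau> \<delta> :: "'a \<Rightarrow> 'a"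
    and \<sigma> :: "(nat \<Rightarrow> 'a) \<Rightarrow> (nat \<Rightarrow> 'a)"
  defines "S \<equiv> skew_poly R \<tau> \<delta>" and "T \<equiv> skew_power_series R I \<tau> \<delta>"
  assumes "ring R" and "carrier R \<noteq> {\<zero>\<^bsub>R\<^esub>}"
    and "ideal I R" and "I \<noteq> carrier R"
    and "adic_separated R I" and "adic_complete R I"
    and "two_sided_noetherian (gr_ring R I)"
    and "\<tau> \<in> ring_iso R R" and "left_skew_derivation R \<tau> \<delta>"
    and "\<tau> ` I = I"
    and "\<exists>\<tau>'. \<tau>' \<in> ring_iso (gr_ring R I) (gr_ring R I) \<and>
           (\<forall>a\<in>carrier R. \<tau>' (gr_symbol R I a) = gr_symbol R I (\<tau> a))"
    and "\<delta> ` carrier R \<subseteq> I" and "\<delta> ` I \<subseteq> ideal_pow R I 2"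
    and "\<sigma> \<in> ring_iso T T" and "\<sigma> \<in> ring_iso S S"
    and "\<forall>r\<in>carrier R. \<sigma> (const_series R r) = const_series R (\<tau> r)"
  shows "(\<forall>Q. tau_delta_prime_ideal R \<tau> \<delta> Q \<longrightarrow>
               (\<exists>P. alpha_prime_ideal T \<sigma> P \<and> contraction R P = Q)) \<and>
         (\<forall>P. alpha_prime_ideal T \<sigma> P \<longrightarrow>
               tau_delta_prime_ideal R \<tau> \<delta> (contraction R P))"
proof -
  interpret ring R by fact
  have "\<one>\<^bsub>R\<^esub> \<noteq> \<zero>\<^bsub>R\<^esub>" using assms(4) one_zeroD by metis
  then interpret skew_noetherian I R \<tau> \<delta> \<sigma>
    using assms
    by (intro skew_noetherian.intro skew_adic_ring.intro adic_ring.intro adic_ring_axioms.intro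
        skew_adic_ring_axioms.intro skew_noetherian_axioms.intro)
      (auto simp: two_sided_noetherian_def ring_iso_def)
  show ?thesis unfolding T_def using exists_prime_over prime_contraction by blast
qed

end
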